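(* Let $\mathbb{K}$ be a commutative ring with unit, $\Sigma$ a compact connected oriented smooth surface with non-empty boundary, $\ast\in\partial\Sigma$, $\pi=\pi_1(\Sigma,\ast)$ and $H=H_1(\Sigma;\mathbb{K})$. For any $\mathbb{K}$-expansion $\theta$ of $\pi$, the composite $\flat\circ\theta_2:\pi\to\mathbb{K}$ of its second term $\theta_2$ with the intersection form $\flat$ is a $\mathbb{K}$-quadratic form: $\flat\circ\theta_2\in Q(\Sigma,\{\ast\};\mathbb{K})$.
   Context: A $\mathbb{K}$-expansion is a map $\theta=\sum_{m\ge0}\theta_m:\pi\to\widehat T(H)=\prod_{m\ge0}H^{\otimes m}$, $\theta_m:\pi\to H^{\otimes m}$, which is a group homomorphism into the multiplicative group of the completed tensor algebra $\widehat T(H)$ and satisfies $\theta_0(\gamma)=1$ and $\theta_1(\gamma)=[\gamma]\in H$ (the homology class) for all $\gamma\in\pi$. $\flat:H^{\otimes2}\to\mathbb{K}$ is the algebraic intersection form, $\flat(X_1\otimes X_2)=X_1\cdot X_2$. $Q(\Sigma,\{\ast\};\mathbb{K})$ is the set of $\mathbb{K}$-quadratic forms on $(\Sigma,\{\ast\})$, i.e. maps $q:\pi\to\mathbb{K}$ with $q(\gamma_1\gamma_2)=q(\gamma_1)+q(\gamma_2)+\gamma_1\cdot\gamma_2$ in $\mathbb{K}$ for all $\gamma_1,\gamma_2\in\pi$, where $\gamma_1\cdot\gamma_2$ is the algebraic intersection number of the homology classes. *)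

theory Defs
  imports "HOL-Analysis.Analysis" "HOL-Homology.Homology" "HOL-Algebra.Module" "HOL-Algebra.AbelCoset"
begin

section \<open>Smooth surfaces with boundary\<close>

definition half_plane :: "(real^2) set" where
  "half_plane = {v. 0 \<le> v $ 2}"

primrec Ck_on :: "nat \<Rightarrow> ('a::real_normed_vector \<Rightarrow> 'b::real_normed_vector) \<Rightarrow> 'a set \<Rightarrow> bool" where
  "Ck_on 0 f S \<longleftrightarrow> continuous_on S f"
| "Ck_on (Suc k) f S \<longleftrightarrow>
     f differentiable_on S \<and> (\<forall>v. Ck_on k (\<lambda>x. frechet_derivative f (at x) v) S)"

text \<open>The predicates \<open>Ck_on\<close> and \<open>smooth_on\<close> are meant for open sets.  On an
  arbitrary set, smoothness means the existence of local smooth extensions.\<close>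

definition smooth_on :: "('a::real_normed_vector \<Rightarrow> 'b::real_normed_vector) \<Rightarrow> 'a set \<Rightarrow> bool" where
  "smooth_on f W \<longleftrightarrow> (\<forall>k. Ck_on k f W)"

definition extends_smoothly_on ::
    "('a::real_normed_vector \<Rightarrow> 'b::real_normed_vector) \<Rightarrow> 'a set \<Rightarrow> bool" where
  "extends_smoothly_on f S \<longleftrightarrow>
     (\<forall>x\<in>S. \<exists>W g. open W \<and> x \<in> W \<and> smooth_on g W \<and> (\<forall>y\<in>W \<inter> S. g y = f y))"

type_synonym 'a chart = "'a set \<times> ('a \<Rightarrow> real^2)"

definition is_chart :: "'a topology \<Rightarrow> 'a chart \<Rightarrow> bool" where
  "is_chart X = (\<lambda>(U, \<phi>). openin X U \<and>
     (\<exists>V. openin (top_of_set half_plane) V \<and>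
          homeomorphic_map (subtopology X U) (top_of_set V) \<phi>))"

text \<open>Smooth and orientation preserving change of coordinates.  The derivative is taken
  within the domain of the transition map, so that it makes sense on the boundary of
  the half plane.\<close>

definition oriented_compatible :: "'a chart \<Rightarrow> 'a chart \<Rightarrow> bool" where
  "oriented_compatible = (\<lambda>(U, \<phi>) (U', \<phi>').
     let D = \<phi> ` (U \<inter> U'); f = \<phi>' \<circ> inv_into U \<phi> in
       extends_smoothly_on f D \<and>
       (\<forall>x\<in>D. \<exists>f'. (f has_derivative f') (at x within D) \<and> det (matrix f') > 0))"

definition oriented_smooth_surface :: "'a topology \<Rightarrow> 'a chart set \<Rightarrow> bool" where
  "oriented_smooth_surface X A \<longleftrightarrow>
     Hausdorff_space X \<and> second_countable X \<and>
     (\<forall>c\<in>A. is_chart X c) \<and> (\<Union>c\<in>A. fst c) = topspace X \<and>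
     (\<forall>c\<in>A. \<forall>c'\<in>A. oriented_compatible c c')"

definition surface_boundary :: "'a chart set \<Rightarrow> 'a set" where
  "surface_boundary A = {p. \<exists>(U, \<phi>)\<in>A. p \<in> U \<and> \<phi> p $ 2 = 0}"


section \<open>The fundamental group\<close>

definition loops :: "'a topology \<Rightarrow> 'a \<Rightarrow> (real \<Rightarrow> 'a) set" where
  "loops X x = {p. pathin X p \<and> p 0 = x \<and> p 1 = x}"

definition path_concat :: "(real \<Rightarrow> 'a) \<Rightarrow> (real \<Rightarrow> 'a) \<Rightarrow> real \<Rightarrow> 'a" where
  "path_concat p q = (\<lambda>t. if t \<le> 1/2 then p (2 * t) else q (2 * t - 1))"

definition homotopy_class :: "'a topology \<Rightarrow> 'a \<Rightarrow> (real \<Rightarrow> 'a) \<Rightarrow> (real \<Rightarrow> 'a) set" where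
  "homotopy_class X x p =
     {q \<in> loops X x. homotopic_with (\<lambda>r. r 0 = x \<and> r 1 = x) (top_of_set {0..1}) X p q}"

definition fundamental_group :: "'a topology \<Rightarrow> 'a \<Rightarrow> (real \<Rightarrow> 'a) set monoid" where
  "fundamental_group X x =
     \<lparr>carrier = homotopy_class X x ` loops X x,
      mult = (\<lambda>c d. \<Union>p\<in>c. \<Union>q\<in>d. homotopy_class X x (path_concat p q)),
      one = homotopy_class X x (\<lambda>t. x)\<rparr>"


section \<open>Free modules and quotient modules\<close>

text \<open>The record type \<open>module\<close> extends that of rings; the ring multiplication and its unit
  play no role for a module and are left undefined.\<close>

definition free_module :: "('k, 'r) ring_scheme \<Rightarrow> 'i set \<Rightarrow> ('k, 'i \<Rightarrow> 'k) module" where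
  "free_module K S =
     \<lparr>carrier = {f. (\<forall>i. f i \<in> carrier K) \<and> finite {i. f i \<noteq> \<zero>\<^bsub>K\<^esub>} \<and> {i. f i \<noteq> \<zero>\<^bsub>K\<^esub>} \<subseteq> S},
      mult = undefined, one = undefined,
      zero = (\<lambda>i. \<zero>\<^bsub>K\<^esub>),
      add = (\<lambda>f g i. f i \<oplus>\<^bsub>K\<^esub> g i),
      smult = (\<lambda>a f i. a \<otimes>\<^bsub>K\<^esub> f i)\<rparr>"

definition free_gen :: "('k, 'r) ring_scheme \<Rightarrow> 'i \<Rightarrow> 'i \<Rightarrow> 'k" where
  "free_gen K i = (\<lambda>j. if j = i then \<one>\<^bsub>K\<^esub> else \<zero>\<^bsub>K\<^esub>)"

definition quotient_module ::
    "('k, 'b) module \<Rightarrow> 'b set \<Rightarrow> ('k, 'b set) module" where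
  "quotient_module M N =
     \<lparr>carrier = a_rcosets\<^bsub>M\<^esub> N,
      mult = undefined, one = undefined,
      zero = N,
      add = (\<lambda>C D. C <+>\<^bsub>M\<^esub> D),
      smult = (\<lambda>a C. \<Union>c\<in>C. N +>\<^bsub>M\<^esub> (a \<odot>\<^bsub>M\<^esub> c))\<rparr>"

definition module_span ::
    "('k, 'r) ring_scheme \<Rightarrow> ('k, 'b) module \<Rightarrow> 'b set \<Rightarrow> 'b set" where
  "module_span K M G = \<Inter>{N. submodule N K M \<and> G \<subseteq> N}"

definition linear_form ::
    "('k, 'r) ring_scheme \<Rightarrow> ('k, 'b) module \<Rightarrow> ('b \<Rightarrow> 'k) \<Rightarrow> bool" where
  "linear_form K M f \<longleftrightarrow>
     f \<in> carrier M \<rightarrow> carrier K \<and>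
     (\<forall>x\<in>carrier M. \<forall>y\<in>carrier M. f (x \<oplus>\<^bsub>M\<^esub> y) = f x \<oplus>\<^bsub>K\<^esub> f y) \<and>
     (\<forall>a\<in>carrier K. \<forall>x\<in>carrier M. f (a \<odot>\<^bsub>M\<^esub> x) = a \<otimes>\<^bsub>K\<^esub> f x)"


section \<open>Singular homology with coefficients in a commutative ring\<close>

text \<open>The library provides singular homology with integer coefficients only.  Simplices and
  faces are those of the library.\<close>

type_synonym 'a sing_simplex = "(nat \<Rightarrow> real) \<Rightarrow> 'a"

definition singular_chains ::
    "('k, 'r) ring_scheme \<Rightarrow> 'a topology \<Rightarrow> nat \<Rightarrow> ('k, 'a sing_simplex \<Rightarrow> 'k) module" where
  "singular_chains K X p = free_module K (singular_simplex_set p X)"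

definition simplex_boundary ::
    "('k, 'r) ring_scheme \<Rightarrow> 'a topology \<Rightarrow> nat \<Rightarrow> 'a sing_simplex \<Rightarrow> 'a sing_simplex \<Rightarrow> 'k" where
  "simplex_boundary K X p \<sigma> =
     (\<Oplus>\<^bsub>singular_chains K X (p - 1)\<^esub> i\<in>{..p}.
        ((\<ominus>\<^bsub>K\<^esub> \<one>\<^bsub>K\<^esub>) [^]\<^bsub>K\<^esub> i) \<odot>\<^bsub>singular_chains K X (p - 1)\<^esub> free_gen K (singular_face p i \<sigma>))"

definition boundary_map ::
    "('k, 'r) ring_scheme \<Rightarrow> 'a topology \<Rightarrow> nat \<Rightarrow> ('a sing_simplex \<Rightarrow> 'k) \<Rightarrow> 'a sing_simplex \<Rightarrow> 'k" where
  "boundary_map K X p c =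
     (if p = 0 then (\<lambda>\<sigma>. \<zero>\<^bsub>K\<^esub>)
      else \<Oplus>\<^bsub>singular_chains K X (p - 1)\<^esub> \<sigma>\<in>{\<sigma>. c \<sigma> \<noteq> \<zero>\<^bsub>K\<^esub>}.
             c \<sigma> \<odot>\<^bsub>singular_chains K X (p - 1)\<^esub> simplex_boundary K X p \<sigma>)"

definition cycles ::
    "('k, 'r) ring_scheme \<Rightarrow> 'a topology \<Rightarrow> nat \<Rightarrow> ('a sing_simplex \<Rightarrow> 'k) set" where
  "cycles K X p = {c \<in> carrier (singular_chains K X p). boundary_map K X p c = (\<lambda>\<sigma>. \<zero>\<^bsub>K\<^esub>)}"

definition boundaries ::
    "('k, 'r) ring_scheme \<Rightarrow> 'a topology \<Rightarrow> nat \<Rightarrow> ('a sing_simplex \<Rightarrow> 'k) set" where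
  "boundaries K X p = boundary_map K X (Suc p) ` carrier (singular_chains K X (Suc p))"

definition homology ::
    "('k, 'r) ring_scheme \<Rightarrow> 'a topology \<Rightarrow> nat \<Rightarrow> ('k, ('a sing_simplex \<Rightarrow> 'k) set) module" where
  "homology K X p =
     quotient_module (singular_chains K X p\<lparr>carrier := cycles K X p\<rparr>) (boundaries K X p)"

text \<open>A path is turned into a singular 1-simplex by means of the second barycentric
  coordinate, so that the simplex runs from \<open>p 0\<close> to \<open>p 1\<close>.\<close>

definition path_simplex :: "(real \<Rightarrow> 'a) \<Rightarrow> 'a sing_simplex" where
  "path_simplex p = restrict (\<lambda>u. p (u 1)) (standard_simplex 1)"

definition closed_path_class ::
    "('k, 'r) ring_scheme \<Rightarrow> 'a topology \<Rightarrow> (real \<Rightarrow> 'a) \<Rightarrow> ('a sing_simplex \<Rightarrow> 'k) set" where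
  "closed_path_class K X p =
     boundaries K X 1 +>\<^bsub>singular_chains K X 1\<^esub> free_gen K (path_simplex p)"

text \<open>The homology class of an element of the fundamental group; homotopic loops are
  homologous, so the choice of the representing loop is immaterial.\<close>

definition homology_class ::
    "('k, 'r) ring_scheme \<Rightarrow> 'a topology \<Rightarrow> (real \<Rightarrow> 'a) set \<Rightarrow> ('a sing_simplex \<Rightarrow> 'k) set" where
  "homology_class K X \<gamma> = closed_path_class K X (SOME p. p \<in> \<gamma>)"


section \<open>Tensor powers and the completed tensor algebra\<close>

text \<open>The \<open>n\<close>-th tensor power of \<open>M\<close> is the free module on the words of length \<open>n\<close> in the
  elements of \<open>M\<close>, modulo the relations expressing linearity in each letter.\<close>

definition words :: "('k, 'b) module \<Rightarrow> nat \<Rightarrow> 'b list set" where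
  "words M n = {w. set w \<subseteq> carrier M \<and> length w = n}"

definition tensor_relations ::
    "('k, 'r) ring_scheme \<Rightarrow> ('k, 'b) module \<Rightarrow> nat \<Rightarrow> ('b list \<Rightarrow> 'k) set" where
  "tensor_relations K M n =
     (let F = free_module K (words M n) in
      {free_gen K (u @ [x \<oplus>\<^bsub>M\<^esub> y] @ v) \<ominus>\<^bsub>F\<^esub>
         (free_gen K (u @ [x] @ v) \<oplus>\<^bsub>F\<^esub> free_gen K (u @ [y] @ v)) | u x y v.
         u @ [x] @ v \<in> words M n \<and> y \<in> carrier M} \<union>
      {free_gen K (u @ [a \<odot>\<^bsub>M\<^esub> x] @ v) \<ominus>\<^bsub>F\<^esub>
         (a \<odot>\<^bsub>F\<^esub> free_gen K (u @ [x] @ v)) | u a x v.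
         u @ [x] @ v \<in> words M n \<and> a \<in> carrier K})"

definition tensor_kernel ::
    "('k, 'r) ring_scheme \<Rightarrow> ('k, 'b) module \<Rightarrow> nat \<Rightarrow> ('b list \<Rightarrow> 'k) set" where
  "tensor_kernel K M n = module_span K (free_module K (words M n)) (tensor_relations K M n)"

definition tensor_power ::
    "('k, 'r) ring_scheme \<Rightarrow> ('k, 'b) module \<Rightarrow> nat \<Rightarrow> ('k, ('b list \<Rightarrow> 'k) set) module" where
  "tensor_power K M n = quotient_module (free_module K (words M n)) (tensor_kernel K M n)"

text \<open>The pure tensor \<open>x\<^sub>1 \<otimes> \<dots> \<otimes> x\<^sub>n\<close>.  For \<open>n = 0\<close> and \<open>n = 1\<close> this gives the canonical
  identifications of \<open>K\<close> (with unit \<open>pure_tensor K M []\<close>) and of \<open>M\<close> (through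
  \<open>x \<mapsto> pure_tensor K M [x]\<close>) with the tensor powers of degree 0 and 1.\<close>

definition pure_tensor ::
    "('k, 'r) ring_scheme \<Rightarrow> ('k, 'b) module \<Rightarrow> 'b list \<Rightarrow> ('b list \<Rightarrow> 'k) set" where
  "pure_tensor K M w =
     tensor_kernel K M (length w) +>\<^bsub>free_module K (words M (length w))\<^esub> free_gen K w"

definition word_convolution ::
    "('k, 'r) ring_scheme \<Rightarrow> ('b list \<Rightarrow> 'k) \<Rightarrow> ('b list \<Rightarrow> 'k) \<Rightarrow> 'b list \<Rightarrow> 'k" where
  "word_convolution K f g w = (\<Oplus>\<^bsub>K\<^esub> i\<in>{..length w}. f (take i w) \<otimes>\<^bsub>K\<^esub> g (drop i w))"

definition tensor_mult ::
    "('k, 'r) ring_scheme \<Rightarrow> ('k, 'b) module \<Rightarrow> nat \<Rightarrow> nat \<Rightarrow>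
     ('b list \<Rightarrow> 'k) set \<Rightarrow> ('b list \<Rightarrow> 'k) set \<Rightarrow> ('b list \<Rightarrow> 'k) set" where
  "tensor_mult K M m n C D =
     (\<Union>f\<in>C. \<Union>g\<in>D.
        tensor_kernel K M (m + n) +>\<^bsub>free_module K (words M (m + n))\<^esub> word_convolution K f g)"

definition completed_tensor_algebra ::
    "('k, 'r) ring_scheme \<Rightarrow> ('k, 'b) module \<Rightarrow> (nat \<Rightarrow> ('b list \<Rightarrow> 'k) set) ring" where
  "completed_tensor_algebra K M =
     \<lparr>carrier = {s. \<forall>m. s m \<in> carrier (tensor_power K M m)},
      mult = (\<lambda>s t m. \<Oplus>\<^bsub>tensor_power K M m\<^esub> i\<in>{..m}. tensor_mult K M i (m - i) (s i) (t (m - i))),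
      one = (\<lambda>m. if m = 0 then pure_tensor K M [] else \<zero>\<^bsub>tensor_power K M m\<^esub>),
      zero = (\<lambda>m. \<zero>\<^bsub>tensor_power K M m\<^esub>),
      add = (\<lambda>s t m. s m \<oplus>\<^bsub>tensor_power K M m\<^esub> t m)\<rparr>"


section \<open>Expansions\<close>

definition is_expansion ::
    "('k, 'r) ring_scheme \<Rightarrow> 'a topology \<Rightarrow> 'a \<Rightarrow>
     ((real \<Rightarrow> 'a) set \<Rightarrow> nat \<Rightarrow> (('a sing_simplex \<Rightarrow> 'k) set list \<Rightarrow> 'k) set) \<Rightarrow> bool" where
  "is_expansion K X x \<theta> \<longleftrightarrow>
     \<theta> \<in> hom (fundamental_group X x) (units_of (completed_tensor_algebra K (homology K X 1))) \<and>
     (\<forall>\<gamma>\<in>carrier (fundamental_group X x).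
        \<theta> \<gamma> 0 = pure_tensor K (homology K X 1) [] \<and>
        \<theta> \<gamma> 1 = pure_tensor K (homology K X 1) [homology_class K X \<gamma>])"


section \<open>The intersection form and quadratic forms\<close>

text \<open>Smooth closed curves are smooth maps on the real line of period 1.\<close>

definition smooth_closed_curve :: "'a topology \<Rightarrow> 'a chart set \<Rightarrow> (real \<Rightarrow> 'a) \<Rightarrow> bool" where
  "smooth_closed_curve X A \<alpha> \<longleftrightarrow>
     continuous_map euclideanreal X \<alpha> \<and> (\<forall>t. \<alpha> (t + 1) = \<alpha> t) \<and>
     (\<forall>(U, \<phi>)\<in>A. smooth_on (\<phi> \<circ> \<alpha>) (\<alpha> -` U))"

definition velocity_det ::
    "('a \<Rightarrow> real^2) \<Rightarrow> (real \<Rightarrow> 'a) \<Rightarrow> (real \<Rightarrow> 'a) \<Rightarrow> real \<Rightarrow> real \<Rightarrow> real" where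
  "velocity_det \<phi> \<alpha> \<beta> s t =
     det (vector [vector_derivative (\<phi> \<circ> \<alpha>) (at s), vector_derivative (\<phi> \<circ> \<beta>) (at t)] :: real^2^2)"

definition transverse :: "'a chart set \<Rightarrow> (real \<Rightarrow> 'a) \<Rightarrow> (real \<Rightarrow> 'a) \<Rightarrow> bool" where
  "transverse A \<alpha> \<beta> \<longleftrightarrow>
     (\<forall>s t. \<alpha> s = \<beta> t \<longrightarrow> (\<forall>(U, \<phi>)\<in>A. \<alpha> s \<in> U \<longrightarrow> velocity_det \<phi> \<alpha> \<beta> s t \<noteq> 0))"

text \<open>The sign is \<open>+1\<close> if the velocity of \<open>\<alpha>\<close> followed by that of \<open>\<beta>\<close> is a positively oriented
  basis.  As all changes of charts preserve the orientation, one chart at the crossing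
  decides.  Crossings are indexed by pairs of parameters, so multiple points are counted
  once for each pair of branches.\<close>

definition crossing_sign ::
    "'a chart set \<Rightarrow> (real \<Rightarrow> 'a) \<Rightarrow> (real \<Rightarrow> 'a) \<Rightarrow> real \<Rightarrow> real \<Rightarrow> int" where
  "crossing_sign A \<alpha> \<beta> s t =
     (if \<exists>(U, \<phi>)\<in>A. \<alpha> s \<in> U \<and> velocity_det \<phi> \<alpha> \<beta> s t > 0 then 1 else -1)"

definition signed_crossings :: "'a chart set \<Rightarrow> (real \<Rightarrow> 'a) \<Rightarrow> (real \<Rightarrow> 'a) \<Rightarrow> int" where
  "signed_crossings A \<alpha> \<beta> =
     (\<Sum>(s, t)\<in>{(s, t). s \<in> {0..<1} \<and> t \<in> {0..<1} \<and> \<alpha> s = \<beta> t}. crossing_sign A \<alpha> \<beta> s t)"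

text \<open>The algebraic intersection form is the linear form on the second tensor power of the
  first homology module which counts the crossings of transverse smooth closed curves with
  signs, the integers being mapped to \<open>K\<close>.  It is uniquely determined, because the
  classes of such curves generate homology and any two curves can be made transverse by a
  homotopy.\<close>

definition is_intersection_form ::
    "('k, 'r) ring_scheme \<Rightarrow> 'a topology \<Rightarrow> 'a chart set \<Rightarrow>
     ((('a sing_simplex \<Rightarrow> 'k) set list \<Rightarrow> 'k) set \<Rightarrow> 'k) \<Rightarrow> bool" where
  "is_intersection_form K X A flat \<longleftrightarrow>
     linear_form K (tensor_power K (homology K X 1) 2) flat \<and>
     (\<forall>\<alpha> \<beta>. smooth_closed_curve X A \<alpha> \<and> smooth_closed_curve X A \<beta> \<and> transverse A \<alpha> \<beta> \<longrightarrow>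
        flat (pure_tensor K (homology K X 1) [closed_path_class K X \<alpha>, closed_path_class K X \<beta>]) =
        add_pow K (signed_crossings A \<alpha> \<beta>) \<one>\<^bsub>K\<^esub>)"

text \<open>The algebraic intersection number of two homology classes, in terms of the
  intersection form \<open>flat\<close>.\<close>

definition intersection_number ::
    "('k, 'r) ring_scheme \<Rightarrow> 'a topology \<Rightarrow> ((('a sing_simplex \<Rightarrow> 'k) set list \<Rightarrow> 'k) set \<Rightarrow> 'k) \<Rightarrow>
     ('a sing_simplex \<Rightarrow> 'k) set \<Rightarrow> ('a sing_simplex \<Rightarrow> 'k) set \<Rightarrow> 'k" where
  "intersection_number K X flat x y = flat (pure_tensor K (homology K X 1) [x, y])"

definition quadratic_forms ::
    "('k, 'r) ring_scheme \<Rightarrow> 'a topology \<Rightarrow> 'a \<Rightarrow>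
     ((('a sing_simplex \<Rightarrow> 'k) set list \<Rightarrow> 'k) set \<Rightarrow> 'k) \<Rightarrow> ((real \<Rightarrow> 'a) set \<Rightarrow> 'k) set" where
  "quadratic_forms K X x flat =
     {q \<in> carrier (fundamental_group X x) \<rightarrow> carrier K.
        \<forall>\<gamma>\<^sub>1\<in>carrier (fundamental_group X x). \<forall>\<gamma>\<^sub>2\<in>carrier (fundamental_group X x).
          q (\<gamma>\<^sub>1 \<otimes>\<^bsub>fundamental_group X x\<^esub> \<gamma>\<^sub>2) =
          q \<gamma>\<^sub>1 \<oplus>\<^bsub>K\<^esub> q \<gamma>\<^sub>2 \<oplus>\<^bsub>K\<^esub>
          intersection_number K X flat (homology_class K X \<gamma>\<^sub>1) (homology_class K X \<gamma>\<^sub>2)}"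

end

theory Submission
  imports Defs
begin

text \<open>
  In degree 2 the product in the completed tensor algebra is
  \<open>(s \<cdot> t)\<^sub>2 = s\<^sub>2 t\<^sub>0 + s\<^sub>1 \<otimes> t\<^sub>1 + s\<^sub>0 t\<^sub>2\<close>.  For \<open>s = \<theta>(\<gamma>\<^sub>1)\<close> and \<open>t = \<theta>(\<gamma>\<^sub>2)\<close>
  this is \<open>\<theta>\<^sub>2(\<gamma>\<^sub>1) + [\<gamma>\<^sub>1] \<otimes> [\<gamma>\<^sub>2] + \<theta>\<^sub>2(\<gamma>\<^sub>2)\<close>, and applying the linear form gives the
  quadratic relation.  As tensor powers are quotients of free modules on words, the
  product formula rests on the fact that convolution of words respects the multilinearity
  relations.
\<close>

section \<open>Linear maps, submodules and quotient modules\<close>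

text \<open>A multilinearity relation changes one letter inside an arbitrary context, so multiplying
  it by a word on either side only lengthens the context and yields a relation again. The passage
  from relations and words to their spans rests on preimages: the elements with the desired property
  form the preimage of a submodule under a linear map, and this contains a span as soon as it
  contains the generators. Products of tensor classes are unions over all representatives; the
  resulting stability of the kernels makes each such union collapse to one coset. Homology itself
  has to be shown to be a module, because the words occurring in a relation stay words only if the
  letters are closed under sums and multiples. Finally, the form is additive only inside the tensor
  square, so every summand must be located there.\<close>

definition linear_map ::
    "('k, 'r) ring_scheme \<Rightarrow> ('k, 'b, 'm) module_scheme \<Rightarrow> ('k, 'c, 'n) module_scheme \<Rightarrow>
     ('b \<Rightarrow> 'c) \<Rightarrow> bool" where
  "linear_map K M N h \<longleftrightarrow>
     h \<in> carrier M \<rightarrow> carrier N \<and>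
     (\<forall>x\<in>carrier M. \<forall>y\<in>carrier M. h (x \<oplus>\<^bsub>M\<^esub> y) = h x \<oplus>\<^bsub>N\<^esub> h y) \<and>
     (\<forall>a\<in>carrier K. \<forall>x\<in>carrier M. h (a \<odot>\<^bsub>M\<^esub> x) = a \<odot>\<^bsub>N\<^esub> h x)"

lemma linear_mapD:
  assumes "linear_map K M N h"
  shows "x \<in> carrier M \<Longrightarrow> h x \<in> carrier N"
    and "\<lbrakk>x \<in> carrier M; y \<in> carrier M\<rbrakk> \<Longrightarrow> h (x \<oplus>\<^bsub>M\<^esub> y) = h x \<oplus>\<^bsub>N\<^esub> h y"
    and "\<lbrakk>a \<in> carrier K; x \<in> carrier M\<rbrakk> \<Longrightarrow> h (a \<odot>\<^bsub>M\<^esub> x) = a \<odot>\<^bsub>N\<^esub> h x"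
  using assms by (auto simp: linear_map_def)

lemma (in module) linear_map_zero:
  assumes "linear_map R M N h" "module R N"
  shows "h \<zero>\<^bsub>M\<^esub> = \<zero>\<^bsub>N\<^esub>"
proof -
  interpret N: module R N by fact
  have "h (\<zero> \<odot>\<^bsub>M\<^esub> \<zero>\<^bsub>M\<^esub>) = \<zero> \<odot>\<^bsub>N\<^esub> h \<zero>\<^bsub>M\<^esub>"
    by (rule linear_mapD(3)[OF assms(1)]) auto
  then show ?thesis
    using linear_mapD(1)[OF assms(1), of "\<zero>\<^bsub>M\<^esub>"] by simp
qed

lemma (in module) linear_map_minus:
  assumes h: "linear_map R M N h" and N: "module R N" and xy: "x \<in> carrier M" "y \<in> carrier M"
  shows "h (x \<ominus>\<^bsub>M\<^esub> y) = h x \<ominus>\<^bsub>N\<^esub> h y"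
proof -
  interpret N: module R N by fact
  have "x \<ominus>\<^bsub>M\<^esub> y = x \<oplus>\<^bsub>M\<^esub> (\<ominus> \<one>) \<odot>\<^bsub>M\<^esub> y"
    using xy by (simp add: a_minus_def smult_l_minus)
  moreover have "h x \<ominus>\<^bsub>N\<^esub> h y = h x \<oplus>\<^bsub>N\<^esub> (\<ominus> \<one>) \<odot>\<^bsub>N\<^esub> h y"
    using linear_mapD(1)[OF h] xy by (simp add: a_minus_def N.smult_l_minus)
  ultimately show ?thesis
    using xy by (simp add: linear_mapD(2,3)[OF h])
qed

text \<open>Negation is scaling by \<open>\<ominus> \<one>\<close>, so closure under scalars already
  gives closure under inverses.\<close>

lemma (in module) submoduleI':
  assumes "H \<subseteq> carrier M" "\<zero>\<^bsub>M\<^esub> \<in> H"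
    and "\<And>x y. \<lbrakk>x \<in> H; y \<in> H\<rbrakk> \<Longrightarrow> x \<oplus>\<^bsub>M\<^esub> y \<in> H"
    and "\<And>a x. \<lbrakk>a \<in> carrier R; x \<in> H\<rbrakk> \<Longrightarrow> a \<odot>\<^bsub>M\<^esub> x \<in> H"
  shows "submodule H R M"
proof (rule submoduleI)
  fix x assume x: "x \<in> H"
  then have "\<ominus>\<^bsub>M\<^esub> x = (\<ominus> \<one>) \<odot>\<^bsub>M\<^esub> x"
    using assms(1) smult_l_minus[of \<one> x] by auto
  then show "\<ominus>\<^bsub>M\<^esub> x \<in> H" using assms(4) x by simp
qed (use assms in auto)

lemma (in module) submodule_zero:
  assumes "submodule H R M"
  shows "\<zero>\<^bsub>M\<^esub> \<in> H"
  using subgroup.one_closed[OF submodule.axioms(1)[OF assms]] by simp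

text \<open>With \<open>module_span_least\<close> this is the induction principle for spans: a
  condition of the form \<open>h x \<in> H\<close> needs checking on generators only. With
  \<open>H\<close> the zero submodule it describes kernels.\<close>

lemma (in module) submodule_vimage:
  assumes h: "linear_map R M N h" and N: "module R N" and H: "submodule H R N"
  shows "submodule {x \<in> carrier M. h x \<in> H} R M"
proof -
  interpret N: module R N by (fact N)
  show ?thesis
    by (rule submoduleI')
      (auto simp: linear_mapD[OF h] linear_map_zero[OF h N] N.submodule_zero[OF H]
         N.submoduleE(4,5)[OF H])
qed

text \<open>Serves twice: boundaries are the image of a boundary map, and a subquotient is an image
  inside a quotient.\<close>

lemma (in module) submodule_image:
  assumes h: "linear_map R M N h" and N: "module R N" and H: "submodule H R M"
  shows "submodule (h ` H) R N"
proof -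
  interpret N: module R N by (fact N)
  note sub = subsetD[OF submoduleE(1)[OF H]]
  show ?thesis
  proof (rule N.submoduleI')
    show "h ` H \<subseteq> carrier N"
      using sub linear_mapD(1)[OF h] by auto
    show "\<zero>\<^bsub>N\<^esub> \<in> h ` H"
      using linear_map_zero[OF h N] submodule_zero[OF H] by (metis imageI)
  next
    fix x y assume "x \<in> h ` H" "y \<in> h ` H"
    then show "x \<oplus>\<^bsub>N\<^esub> y \<in> h ` H"
      using sub linear_mapD(2)[OF h] submoduleE(5)[OF H] by (auto simp flip: linear_mapD(2)[OF h])
  next
    fix a x assume "a \<in> carrier R" "x \<in> h ` H"
    then show "a \<odot>\<^bsub>N\<^esub> x \<in> h ` H"
      using sub submoduleE(4)[OF H] by (auto simp flip: linear_mapD(3)[OF h])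
  qed
qed

lemma (in module) submodule_Inter:
  assumes "\<And>N. N \<in> \<N> \<Longrightarrow> submodule N R M" "\<N> \<noteq> {}"
  shows "submodule (\<Inter>\<N>) R M"
proof (rule submoduleI')
  show "\<Inter>\<N> \<subseteq> carrier M"
    using assms submoduleE(1) by blast
qed (use assms submodule_zero submoduleE(4,5) in auto)

text \<open>The whole carrier is a submodule containing \<open>G\<close>, so the intersection runs
  over a non-empty family.\<close>

lemma submodule_module_span:
  assumes "module K M" "G \<subseteq> carrier M"
  shows "submodule (module_span K M G) K M"
  unfolding module_span_def
  using assms by (intro module.submodule_Inter) (auto intro: module.carrier_is_submodule)

lemma module_span_superset: "G \<subseteq> module_span K M G"
  by (auto simp: module_span_def)

lemma module_span_least: "\<lbrakk>submodule N K M; G \<subseteq> N\<rbrakk> \<Longrightarrow> module_span K M G \<subseteq> N"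
  by (auto simp: module_span_def)

section \<open>Quotients of a module by a submodule\<close>

lemma quotient_module_simps [simp]:
  "carrier (quotient_module M N) = a_rcosets\<^bsub>M\<^esub> N"
  "zero (quotient_module M N) = N"
  "add (quotient_module M N) = (\<lambda>C D. C <+>\<^bsub>M\<^esub> D)"
  "smult (quotient_module M N) = (\<lambda>a C. \<Union>c\<in>C. N +>\<^bsub>M\<^esub> (a \<odot>\<^bsub>M\<^esub> c))"
  by (simp_all add: quotient_module_def)

lemma (in module) abelian_subgroup_submodule:
  assumes "submodule N R M"
  shows "abelian_subgroup N M"
  using assms by (intro abelian_subgroupI2 a_comm_group submodule.axioms(1))

context
  fixes K :: "('k, 'r) ring_scheme" and M :: "('k, 'b) module" and N :: "'b set"
  assumes module_M: "module K M" and submodule_N: "submodule N K M"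
begin

interpretation module K M by (fact module_M)
interpretation N: abelian_subgroup N M by (rule abelian_subgroup_submodule[OF submodule_N])

lemma rcoset_eqI:
  assumes "c \<in> N +>\<^bsub>M\<^esub> x" "x \<in> carrier M"
  shows "N +>\<^bsub>M\<^esub> c = N +>\<^bsub>M\<^esub> x"
  by (rule a_repr_independence[OF assms N.a_subgroup, symmetric])

text \<open>Scaling a coset is defined as a union over its representatives. Two representatives
  differ by an element of \<open>N\<close>, and so do their multiples, hence all members of the
  union agree.\<close>

lemma smult_rcoset:
  assumes a: "a \<in> carrier K" and x: "x \<in> carrier M"
  shows "a \<odot>\<^bsub>quotient_module M N\<^esub> (N +>\<^bsub>M\<^esub> x) = N +>\<^bsub>M\<^esub> (a \<odot>\<^bsub>M\<^esub> x)"
proof -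
  have "N +>\<^bsub>M\<^esub> (a \<odot>\<^bsub>M\<^esub> c) = N +>\<^bsub>M\<^esub> (a \<odot>\<^bsub>M\<^esub> x)" if "c \<in> N +>\<^bsub>M\<^esub> x" for c
  proof -
    from that obtain n where n: "n \<in> N" "c = n \<oplus>\<^bsub>M\<^esub> x"
      by (auto simp: a_r_coset_def')
    then have "a \<odot>\<^bsub>M\<^esub> c = (a \<odot>\<^bsub>M\<^esub> n) \<oplus>\<^bsub>M\<^esub> (a \<odot>\<^bsub>M\<^esub> x)"
      using a x by (simp add: smult_r_distr)
    then have "a \<odot>\<^bsub>M\<^esub> c \<in> N +>\<^bsub>M\<^esub> (a \<odot>\<^bsub>M\<^esub> x)"
      using submoduleE(4)[OF submodule_N a n(1)] by (auto simp: a_r_coset_def')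
    then show ?thesis using a x by (intro rcoset_eqI) auto
  qed
  then have "(\<Union>c\<in>N +>\<^bsub>M\<^esub> x. N +>\<^bsub>M\<^esub> (a \<odot>\<^bsub>M\<^esub> c)) = (\<Union>c\<in>N +>\<^bsub>M\<^esub> x. N +>\<^bsub>M\<^esub> (a \<odot>\<^bsub>M\<^esub> x))"
    by (intro SUP_cong refl)
  \<comment> \<open>A union of copies of one set equals that set only over a non-empty index
    set.\<close>
  moreover have "N +>\<^bsub>M\<^esub> x \<noteq> {}" using N.a_rcos_self[OF x] by blast
  ultimately show ?thesis by simp
qed

text \<open>Available before the quotient is known to be a module, because \<open>linear_map\<close>
  asks nothing of its target. The module axioms are then carried over along this surjection.\<close>

lemma linear_map_rcoset: "linear_map K M (quotient_module M N) (\<lambda>x. N +>\<^bsub>M\<^esub> x)"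
  unfolding linear_map_def
proof (intro conjI ballI funcsetI)
  fix x y assume "x \<in> carrier M" "y \<in> carrier M"
  then show "N +>\<^bsub>M\<^esub> (x \<oplus>\<^bsub>M\<^esub> y) = (N +>\<^bsub>M\<^esub> x) \<oplus>\<^bsub>quotient_module M N\<^esub> (N +>\<^bsub>M\<^esub> y)"
    by (simp add: N.a_rcos_sum)
next
  fix x assume "x \<in> carrier M"
  then show "N +>\<^bsub>M\<^esub> x \<in> carrier (quotient_module M N)"
    by (auto simp: A_RCOSETS_def')
qed (rule smult_rcoset[symmetric])

text \<open>Every coset comes from an element of \<open>M\<close>, so each axiom is the image of the
  same axiom in \<open>M\<close>; the inverse of a coset is the coset of the inverse.\<close>

lemma abelian_group_quotient_module: "abelian_group (quotient_module M N)"
proof -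
  let ?Q = "quotient_module M N" and ?q = "\<lambda>x. N +>\<^bsub>M\<^esub> x"
  note lin = linear_mapD[OF linear_map_rcoset]
  have Q: "carrier ?Q = ?q ` carrier M" by (auto simp: A_RCOSETS_def')
  have zero: "\<zero>\<^bsub>?Q\<^esub> = ?q \<zero>\<^bsub>M\<^esub>"
    using submoduleE(1)[OF submodule_N] by (simp add: a_coset_add_zero)
  show ?thesis
  proof (rule abelian_groupI)
    fix C D assume "C \<in> carrier ?Q" "D \<in> carrier ?Q"
    then obtain x y where xy: "x \<in> carrier M" "y \<in> carrier M" and CD: "C = ?q x" "D = ?q y"
      unfolding Q by blast
    show "C \<oplus>\<^bsub>?Q\<^esub> D \<in> carrier ?Q"
      unfolding CD lin(2)[OF xy, symmetric] using xy by (intro lin(1)) simp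
    show "C \<oplus>\<^bsub>?Q\<^esub> D = D \<oplus>\<^bsub>?Q\<^esub> C"
      unfolding CD lin(2)[OF xy, symmetric] lin(2)[OF xy(2,1), symmetric]
      using xy by (simp only: M.a_comm)
    fix E assume "E \<in> carrier ?Q"
    then obtain z where z: "z \<in> carrier M" and E: "E = ?q z" unfolding Q by blast
    have "(C \<oplus>\<^bsub>?Q\<^esub> D) \<oplus>\<^bsub>?Q\<^esub> E = ?q ((x \<oplus>\<^bsub>M\<^esub> y) \<oplus>\<^bsub>M\<^esub> z)"
      using xy z by (simp only: CD E lin(2) M.add.m_closed)
    also have "\<dots> = ?q (x \<oplus>\<^bsub>M\<^esub> (y \<oplus>\<^bsub>M\<^esub> z))"
      using xy z by (simp only: M.a_assoc)
    also have "\<dots> = C \<oplus>\<^bsub>?Q\<^esub> (D \<oplus>\<^bsub>?Q\<^esub> E)"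
      using xy z by (simp only: CD E lin(2) M.add.m_closed)
    finally show "(C \<oplus>\<^bsub>?Q\<^esub> D) \<oplus>\<^bsub>?Q\<^esub> E = C \<oplus>\<^bsub>?Q\<^esub> (D \<oplus>\<^bsub>?Q\<^esub> E)" .
  next
    show "\<zero>\<^bsub>?Q\<^esub> \<in> carrier ?Q" unfolding zero by (intro lin(1)) simp
  next
    fix C assume "C \<in> carrier ?Q"
    then obtain x where x: "x \<in> carrier M" and C: "C = ?q x" unfolding Q by blast
    show "\<zero>\<^bsub>?Q\<^esub> \<oplus>\<^bsub>?Q\<^esub> C = C"
      unfolding C zero lin(2)[OF M.zero_closed x, symmetric] using x by (simp only: M.l_zero)
    have "?q (\<ominus>\<^bsub>M\<^esub> x) \<oplus>\<^bsub>?Q\<^esub> C = \<zero>\<^bsub>?Q\<^esub>"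
      unfolding C zero lin(2)[OF M.a_inv_closed[OF x] x, symmetric] using x by (simp only: M.l_neg)
    moreover have "?q (\<ominus>\<^bsub>M\<^esub> x) \<in> carrier ?Q" using x by (intro lin(1)) simp
    ultimately show "\<exists>D\<in>carrier ?Q. D \<oplus>\<^bsub>?Q\<^esub> C = \<zero>\<^bsub>?Q\<^esub>" by blast
  qed
qed

lemma module_quotient_module: "module K (quotient_module M N)"
proof -
  interpret Q: abelian_group "quotient_module M N" by (rule abelian_group_quotient_module)
  let ?Q = "quotient_module M N" and ?q = "\<lambda>x. N +>\<^bsub>M\<^esub> x"
  note lin = linear_mapD[OF linear_map_rcoset]
  have Q: "carrier ?Q = ?q ` carrier M" by (auto simp: A_RCOSETS_def')
  show ?thesis
  proof (rule moduleI[OF R.is_cring Q.abelian_group_axioms])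
    fix a C assume a: "a \<in> carrier K" and "C \<in> carrier ?Q"
    then obtain x where x: "x \<in> carrier M" and C: "C = ?q x" unfolding Q by blast
    show "a \<odot>\<^bsub>?Q\<^esub> C \<in> carrier ?Q"
      unfolding C lin(3)[OF a x, symmetric] using a x by (intro lin(1)) simp
    fix b assume b: "b \<in> carrier K"
    have "(a \<oplus>\<^bsub>K\<^esub> b) \<odot>\<^bsub>?Q\<^esub> C = ?q (a \<odot>\<^bsub>M\<^esub> x \<oplus>\<^bsub>M\<^esub> b \<odot>\<^bsub>M\<^esub> x)"
      using a b x lin(3)[of "a \<oplus>\<^bsub>K\<^esub> b" x] by (simp only: C smult_l_distr R.add.m_closed)
    also have "\<dots> = a \<odot>\<^bsub>?Q\<^esub> C \<oplus>\<^bsub>?Q\<^esub> b \<odot>\<^bsub>?Q\<^esub> C"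
      using a b x by (simp only: C lin smult_closed)
    finally show "(a \<oplus>\<^bsub>K\<^esub> b) \<odot>\<^bsub>?Q\<^esub> C = a \<odot>\<^bsub>?Q\<^esub> C \<oplus>\<^bsub>?Q\<^esub> b \<odot>\<^bsub>?Q\<^esub> C" .
    have "(a \<otimes>\<^bsub>K\<^esub> b) \<odot>\<^bsub>?Q\<^esub> C = ?q (a \<odot>\<^bsub>M\<^esub> (b \<odot>\<^bsub>M\<^esub> x))"
      using a b x lin(3)[of "a \<otimes>\<^bsub>K\<^esub> b" x] by (simp only: C smult_assoc1 R.m_closed)
    also have "\<dots> = a \<odot>\<^bsub>?Q\<^esub> (b \<odot>\<^bsub>?Q\<^esub> C)"
      using a b x by (simp only: C lin smult_closed)
    finally show "(a \<otimes>\<^bsub>K\<^esub> b) \<odot>\<^bsub>?Q\<^esub> C = a \<odot>\<^bsub>?Q\<^esub> (b \<odot>\<^bsub>?Q\<^esub> C)" .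
  next
    fix a C D assume a: "a \<in> carrier K" and "C \<in> carrier ?Q" "D \<in> carrier ?Q"
    then obtain x y where xy: "x \<in> carrier M" "y \<in> carrier M" and CD: "C = ?q x" "D = ?q y"
      unfolding Q by blast
    have "a \<odot>\<^bsub>?Q\<^esub> (C \<oplus>\<^bsub>?Q\<^esub> D) = ?q (a \<odot>\<^bsub>M\<^esub> x \<oplus>\<^bsub>M\<^esub> a \<odot>\<^bsub>M\<^esub> y)"
      using a xy lin(3)[of a "x \<oplus>\<^bsub>M\<^esub> y"] by (simp only: CD lin(2) smult_r_distr M.add.m_closed)
    also have "\<dots> = a \<odot>\<^bsub>?Q\<^esub> C \<oplus>\<^bsub>?Q\<^esub> a \<odot>\<^bsub>?Q\<^esub> D"
      using a xy by (simp only: CD lin smult_closed)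
    finally show "a \<odot>\<^bsub>?Q\<^esub> (C \<oplus>\<^bsub>?Q\<^esub> D) = a \<odot>\<^bsub>?Q\<^esub> C \<oplus>\<^bsub>?Q\<^esub> a \<odot>\<^bsub>?Q\<^esub> D" .
  next
    fix C assume "C \<in> carrier ?Q"
    then obtain x where x: "x \<in> carrier M" and C: "C = ?q x" unfolding Q by blast
    show "\<one>\<^bsub>K\<^esub> \<odot>\<^bsub>?Q\<^esub> C = C"
      unfolding C lin(3)[OF R.one_closed x, symmetric] using x by (simp only: smult_one)
  qed
qed

text \<open>The subquotient is the image of \<open>Z\<close> in the quotient by \<open>N\<close>, so the inclusion
  of \<open>N\<close> in \<open>Z\<close> plays no role; for homology this avoids showing that boundaries are cycles.\<close>

lemma module_subquotient:
  assumes "submodule Z K M"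
  shows "module K (quotient_module (M\<lparr>carrier := Z\<rparr>) N)"
proof -
  \<comment> \<open>Cosets, their sums and their multiples refer only to the operations of
    \<open>M\<close>, which a restriction of the carrier leaves unchanged. Only the set of cosets
    gets smaller.\<close>
  have "quotient_module (M\<lparr>carrier := Z\<rparr>) N =
      (quotient_module M N)\<lparr>carrier := (\<lambda>x. N +>\<^bsub>M\<^esub> x) ` Z\<rparr>"
    by (auto simp: quotient_module_def A_RCOSETS_def' a_r_coset_def' set_add_def')
  then show ?thesis
    using submodule.submodule_is_module[OF submodule_image[OF linear_map_rcoset
      module_quotient_module assms] module_quotient_module] by simp
qed

end


section \<open>Free modules\<close>

lemma free_module_simps [simp]:
  "zero (free_module K S) = (\<lambda>i. \<zero>\<^bsub>K\<^esub>)"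
  "add (free_module K S) = (\<lambda>f g i. f i \<oplus>\<^bsub>K\<^esub> g i)"
  "smult (free_module K S) = (\<lambda>a f i. a \<otimes>\<^bsub>K\<^esub> f i)"
  by (simp_all add: free_module_def)

lemma carrier_free_module:
  "f \<in> carrier (free_module K S) \<longleftrightarrow>
     (\<forall>i. f i \<in> carrier K) \<and> finite {i. f i \<noteq> \<zero>\<^bsub>K\<^esub>} \<and> {i. f i \<noteq> \<zero>\<^bsub>K\<^esub>} \<subseteq> S"
  by (simp add: free_module_def)

context cring
begin

lemma module_free_module: "module R (free_module R S)"
proof (rule moduleI)
  have add: "(\<lambda>i. f i \<oplus> g i) \<in> carrier (free_module R S)"
    if "f \<in> carrier (free_module R S)" "g \<in> carrier (free_module R S)" for f g
  proof -
    have "{i. f i \<oplus> g i \<noteq> \<zero>} \<subseteq> {i. f i \<noteq> \<zero>} \<union> {i. g i \<noteq> \<zero>}" by auto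
    then show ?thesis
      using that finite_subset[of "{i. f i \<oplus> g i \<noteq> \<zero>}" "{i. f i \<noteq> \<zero>} \<union> {i. g i \<noteq> \<zero>}"]
      by (auto simp: carrier_free_module)
  qed
  have smult: "(\<lambda>i. a \<otimes> f i) \<in> carrier (free_module R S)"
    if "a \<in> carrier R" "f \<in> carrier (free_module R S)" for a f
  proof -
    have "{i. a \<otimes> f i \<noteq> \<zero>} \<subseteq> {i. f i \<noteq> \<zero>}" using that by auto
    then show ?thesis
      using that finite_subset[of "{i. a \<otimes> f i \<noteq> \<zero>}" "{i. f i \<noteq> \<zero>}"]
      by (auto simp: carrier_free_module)
  qed
  show "abelian_group (free_module R S)"
  proof (rule abelian_groupI)
    fix f assume f: "f \<in> carrier (free_module R S)"
    show "\<exists>g\<in>carrier (free_module R S). g \<oplus>\<^bsub>free_module R S\<^esub> f = \<zero>\<^bsub>free_module R S\<^esub>"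
      using smult[of "\<ominus> \<one>" f] f
      by (intro bexI[where x = "\<lambda>i. \<ominus> \<one> \<otimes> f i"])
        (auto simp: carrier_free_module l_minus l_neg)
  qed (use add in \<open>auto simp: carrier_free_module a_ac fun_eq_iff\<close>)
  show "cring R" by (rule is_cring)
  show "a \<odot>\<^bsub>free_module R S\<^esub> f \<in> carrier (free_module R S)"
    if "a \<in> carrier R" "f \<in> carrier (free_module R S)" for a f
    using smult[OF that] by simp
qed (auto simp: carrier_free_module l_distr r_distr m_assoc)

lemma free_gen_closed: "i \<in> S \<Longrightarrow> free_gen R i \<in> carrier (free_module R S)"
  by (auto simp: carrier_free_module free_gen_def)

lemma free_gen_apply_closed [simp]: "free_gen R i j \<in> carrier R"
  by (simp add: free_gen_def)

lemma free_module_subset: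
  assumes N: "submodule N R (free_module R S)" and gen: "\<And>i. i \<in> S \<Longrightarrow> free_gen R i \<in> N"
  shows "carrier (free_module R S) \<subseteq> N"
proof
  interpret F: module R "free_module R S" by (rule module_free_module)
  fix f assume f: "f \<in> carrier (free_module R S)"
  then have "finite {i. f i \<noteq> \<zero>}" by (simp add: carrier_free_module)
  then show "f \<in> N"
    using f
  proof (induction "{i. f i \<noteq> \<zero>}" arbitrary: f rule: finite_induct)
    case empty
    then have "f = \<zero>\<^bsub>free_module R S\<^esub>" by auto
    then show ?case using F.submodule_zero[OF N] by simp
  next
    case (insert j T)
    \<comment> \<open>Clearing the coordinate \<open>j\<close> leaves exactly the support
      \<open>T\<close>; the lost part is \<open>f j\<close> times the generator at
      \<open>j\<close>.\<close>
    let ?g = "f(j := \<zero>)"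
    have T: "{i. ?g i \<noteq> \<zero>} = T" using insert.hyps by auto
    have f: "f i \<in> carrier R" for i
      using insert.prems by (simp add: carrier_free_module)
    have "{i. f i \<noteq> \<zero>} \<subseteq> S"
      using insert.prems by (simp add: carrier_free_module)
    then have jS: "j \<in> S" and "T \<subseteq> S" using insert.hyps by auto
    then have "?g \<in> carrier (free_module R S)"
      using insert.hyps(1) f unfolding carrier_free_module T by simp
    then have "?g \<in> N" using insert.hyps(3)[of ?g] T by simp
    moreover have "f j \<odot>\<^bsub>free_module R S\<^esub> free_gen R j \<in> N"
      using F.submoduleE(4)[OF N f gen[OF jS]] .
    ultimately have "?g \<oplus>\<^bsub>free_module R S\<^esub> (f j \<odot>\<^bsub>free_module R S\<^esub> free_gen R j) \<in> N"
      using F.submoduleE(5)[OF N] by blast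
    moreover have "?g \<oplus>\<^bsub>free_module R S\<^esub> (f j \<odot>\<^bsub>free_module R S\<^esub> free_gen R j) = f"
      using f by (auto simp: free_gen_def)
    ultimately show ?case by simp
  qed
qed

text \<open>Existence half of the universal property: \<open>B\<close> on the generators extends
  linearly.\<close>

lemma linear_map_free_module:
  assumes M: "module R M" and B: "B \<in> S \<rightarrow> carrier M"
  shows "linear_map R (free_module R S) M
    (\<lambda>c. \<Oplus>\<^bsub>M\<^esub> s\<in>{s. c s \<noteq> \<zero>}. c s \<odot>\<^bsub>M\<^esub> B s)"
    (is "linear_map R ?F M ?h")
proof -
  interpret M: module R M by (fact M)
  have c: "c s \<in> carrier R" if "c \<in> carrier ?F" for c s
    using that by (simp add: carrier_free_module)
  have sub: "{s. c s \<noteq> \<zero>} \<subseteq> S" "finite {s. c s \<noteq> \<zero>}" if "c \<in> carrier ?F" for c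
    using that by (auto simp: carrier_free_module)
  have summand: "(\<lambda>s. c s \<odot>\<^bsub>M\<^esub> B s) \<in> S \<rightarrow> carrier M" if "c \<in> carrier ?F" for c
    using B c[OF that] by auto
  \<comment> \<open>The range of summation depends on \<open>c\<close>. Padding it with zero terms
    to a common finite set \<open>T\<close> makes sums for different elements comparable.\<close>
  have extend: "?h c = (\<Oplus>\<^bsub>M\<^esub> s\<in>T. c s \<odot>\<^bsub>M\<^esub> B s)"
    if "c \<in> carrier ?F" "finite T" "T \<subseteq> S" "{s. c s \<noteq> \<zero>} \<subseteq> T" for c T
    using that B summand[OF that(1)]
    by (intro M.add.finprod_mono_neutral_cong_left)
      (auto intro!: M.smult_l_null simp: Pi_def subset_iff)
  interpret F: module R ?F by (rule module_free_module)
  show ?thesis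
    unfolding linear_map_def
  proof (intro conjI ballI funcsetI)
    fix c assume "c \<in> carrier ?F"
    then show "?h c \<in> carrier M"
      using sub[of c] summand[of c] by (intro M.finsum_closed) auto
  next
    fix c d assume cd: "c \<in> carrier ?F" "d \<in> carrier ?F"
    define T where "T = {s. c s \<noteq> \<zero>} \<union> {s. d s \<noteq> \<zero>}"
    have T: "finite T" "T \<subseteq> S" using sub[OF cd(1)] sub[OF cd(2)] by (auto simp: T_def)
    have "?h (c \<oplus>\<^bsub>?F\<^esub> d) = (\<Oplus>\<^bsub>M\<^esub> s\<in>T. (c \<oplus>\<^bsub>?F\<^esub> d) s \<odot>\<^bsub>M\<^esub> B s)"
      using T cd by (intro extend F.add.m_closed) (auto simp: T_def)
    also have "\<dots> = (\<Oplus>\<^bsub>M\<^esub> s\<in>T. c s \<odot>\<^bsub>M\<^esub> B s \<oplus>\<^bsub>M\<^esub> d s \<odot>\<^bsub>M\<^esub> B s)"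
      using T B c cd by (intro M.finsum_cong') (auto simp: M.smult_l_distr Pi_def subset_iff)
    also have "\<dots> = (\<Oplus>\<^bsub>M\<^esub> s\<in>T. c s \<odot>\<^bsub>M\<^esub> B s) \<oplus>\<^bsub>M\<^esub> (\<Oplus>\<^bsub>M\<^esub> s\<in>T. d s \<odot>\<^bsub>M\<^esub> B s)"
      using T summand[OF cd(1)] summand[OF cd(2)] by (intro M.finsum_addf) auto
    also have "\<dots> = ?h c \<oplus>\<^bsub>M\<^esub> ?h d"
      using T cd by (intro arg_cong2[where f = "add M"] extend[symmetric]) (auto simp: T_def)
    finally show "?h (c \<oplus>\<^bsub>?F\<^esub> d) = ?h c \<oplus>\<^bsub>M\<^esub> ?h d" .
  next
    fix a c assume ac: "a \<in> carrier R" "c \<in> carrier ?F"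
    let ?T = "{s. c s \<noteq> \<zero>}"
    note T = sub[OF ac(2)]
    \<comment> \<open>Scaling may shrink the support, so both sides are compared on the support of
      \<open>c\<close>.\<close>
    have "?h (a \<odot>\<^bsub>?F\<^esub> c) = (\<Oplus>\<^bsub>M\<^esub> s\<in>?T. (a \<odot>\<^bsub>?F\<^esub> c) s \<odot>\<^bsub>M\<^esub> B s)"
      using T ac by (intro extend F.smult_closed) auto
    also have "\<dots> = (\<Oplus>\<^bsub>M\<^esub> s\<in>?T. a \<odot>\<^bsub>M\<^esub> (c s \<odot>\<^bsub>M\<^esub> B s))"
      using T B c ac by (intro M.finsum_cong') (auto simp: M.smult_assoc1 Pi_def subset_iff)
    also have "\<dots> = a \<odot>\<^bsub>M\<^esub> ?h c"
      using T summand[OF ac(2)] ac(1) by (intro M.finsum_smult_ldistr[symmetric]) auto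
    finally show "?h (a \<odot>\<^bsub>?F\<^esub> c) = a \<odot>\<^bsub>M\<^esub> ?h c" .
  qed
qed


section \<open>Homology is a module\<close>

lemma module_singular_chains: "module R (singular_chains R X p)"
  unfolding singular_chains_def by (rule module_free_module)

lemma simplex_boundary_closed:
  assumes "1 \<le> p" "\<sigma> \<in> singular_simplex_set p X"
  shows "simplex_boundary R X p \<sigma> \<in> carrier (singular_chains R X (p - 1))"
proof -
  interpret C: module R "singular_chains R X (p - 1)" by (rule module_singular_chains)
  have "free_gen R (singular_face p i \<sigma>) \<in> carrier (singular_chains R X (p - 1))" if "i \<le> p" for i
    using assms that singular_simplex_singular_face[of p X \<sigma> i]
    unfolding singular_chains_def by (intro free_gen_closed) auto
  then show ?thesis
    unfolding simplex_boundary_def by (intro C.finsum_closed funcsetI C.smult_closed) auto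
qed

text \<open>In positive degree the boundary map is literally the linear extension of
  \<open>simplex_boundary\<close> from the simplices.\<close>

lemma linear_map_boundary_map:
  assumes "1 \<le> p"
  shows "linear_map R (singular_chains R X p) (singular_chains R X (p - 1)) (boundary_map R X p)"
proof -
  have "boundary_map R X p = (\<lambda>c. \<Oplus>\<^bsub>singular_chains R X (p - 1)\<^esub> \<sigma>\<in>{\<sigma>. c \<sigma> \<noteq> \<zero>}.
      c \<sigma> \<odot>\<^bsub>singular_chains R X (p - 1)\<^esub> simplex_boundary R X p \<sigma>)"
    using assms by (auto simp: boundary_map_def fun_eq_iff)
  moreover have "linear_map R (free_module R (singular_simplex_set p X)) (singular_chains R X (p - 1)) \<dots>"
    using assms simplex_boundary_closed
    by (intro linear_map_free_module module_singular_chains) blast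
  ultimately show ?thesis by (simp add: singular_chains_def)
qed

lemma submodule_boundaries: "submodule (boundaries R X p) R (singular_chains R X p)"
proof -
  interpret C: module R "singular_chains R X (Suc p)" by (rule module_singular_chains)
  show ?thesis
    using C.submodule_image[OF linear_map_boundary_map[of "Suc p" X] module_singular_chains
      C.carrier_is_submodule]
    by (simp add: boundaries_def)
qed

lemma submodule_cycles:
  assumes "1 \<le> p"
  shows "submodule (cycles R X p) R (singular_chains R X p)"
proof -
  interpret C: module R "singular_chains R X p" by (rule module_singular_chains)
  interpret D: module R "singular_chains R X (p - 1)" by (rule module_singular_chains)
  \<comment> \<open>Cycles are the preimage of the zero submodule.\<close>
  have "submodule {\<zero>\<^bsub>singular_chains R X (p - 1)\<^esub>} R (singular_chains R X (p - 1))"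
    by (rule D.submoduleI') (auto simp del: One_nat_def)
  from C.submodule_vimage[OF linear_map_boundary_map[OF assms] module_singular_chains this]
  show ?thesis by (simp add: cycles_def singular_chains_def)
qed

lemma module_homology: "1 \<le> p \<Longrightarrow> module R (homology R X p)"
  unfolding homology_def
  by (intro module_subquotient module_singular_chains submodule_boundaries submodule_cycles)

end


section \<open>Multiplication in the tensor algebra\<close>

text \<open>If \<open>f\<close> lives on words of length \<open>m\<close>, the only cut of
  \<open>w\<close> that can contribute is the one after \<open>m\<close> letters.\<close>

lemma (in cring) word_convolution_homogeneous:
  assumes "\<And>u. f u \<in> carrier R" "\<And>u. g u \<in> carrier R" "\<And>u. f u \<noteq> \<zero> \<Longrightarrow> length u = m"
  shows "word_convolution R f g w =
    (if m \<le> length w then f (take m w) \<otimes> g (drop m w) else \<zero>)"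
proof -
  \<comment> \<open>The bound on \<open>i\<close> matters: only then does \<open>take i w\<close>
    have length \<open>i\<close>.\<close>
  have zero: "f (take i w) = \<zero>" if "i \<le> length w" "i \<noteq> m" for i
    using assms(3)[of "take i w"] that by auto
  have "word_convolution R f g w =
      (\<Oplus>i\<in>{..length w}. if m = i then f (take i w) \<otimes> g (drop i w) else \<zero>)"
    unfolding word_convolution_def
    by (intro finsum_cong') (auto simp: assms(1,2) zero)
  also have "\<dots> = (if m \<le> length w then f (take m w) \<otimes> g (drop m w) else \<zero>)"
  proof (cases "m \<le> length w")
    case True
    then show ?thesis
      using finsum_singleton[of m "{..length w}" "\<lambda>i. f (take i w) \<otimes> g (drop i w)"]
      by (simp add: assms(1,2))
  next
    case False
    then have "(\<Oplus>i\<in>{..length w}. if m = i then f (take i w) \<otimes> g (drop i w) else \<zero>) =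
        (\<Oplus>i\<in>{..length w}. \<zero>)"
      by (intro finsum_cong') auto
    then show ?thesis using False by simp
  qed
  finally show ?thesis .
qed

text \<open>This identifies convolution as the bilinear extension of concatenation, the product of
  the free algebra.\<close>

lemma (in cring) word_convolution_free_gen:
  "word_convolution R (free_gen R u) (free_gen R v) = free_gen R (u @ v)"
proof
  fix w
  have "word_convolution R (free_gen R u) (free_gen R v) w =
    (if length u \<le> length w
     then free_gen R u (take (length u) w) \<otimes> free_gen R v (drop (length u) w) else \<zero>)"
    by (intro word_convolution_homogeneous) (auto simp: free_gen_def split: if_splits)
  also have "\<dots> = free_gen R (u @ v) w"
    by (auto simp: free_gen_def) (metis append_take_drop_id)
  finally show "word_convolution R (free_gen R u) (free_gen R v) w = free_gen R (u @ v) w" .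
qed

lemma (in cring) word_convolution_Nil_left:
  assumes "\<And>u. g u \<in> carrier R"
  shows "word_convolution R (free_gen R []) g = g"
proof
  fix w
  show "word_convolution R (free_gen R []) g w = g w"
    using assms by (subst word_convolution_homogeneous[where m = 0])
      (auto simp: free_gen_def split: if_splits)
qed

text \<open>The left factor dictates the cut, so its degree \<open>m\<close> has to be given. After
  the cut the right factor receives the empty word exactly when \<open>w\<close> has length
  \<open>m\<close>.\<close>

lemma (in cring) word_convolution_Nil_right:
  assumes "\<And>u. f u \<in> carrier R" "\<And>u. f u \<noteq> \<zero> \<Longrightarrow> length u = m"
  shows "word_convolution R f (free_gen R []) = f"
proof
  fix w
  have "f w = \<zero>" if "length w \<noteq> m" using assms(2) that by blast
  then show "word_convolution R f (free_gen R []) w = f w"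
    using assms by (subst word_convolution_homogeneous[where m = m])
      (auto simp: free_gen_def)
qed

section \<open>Convolution of homogeneous elements as a bilinear map\<close>

context
  fixes K :: "('k, 'r) ring_scheme" and M :: "('k, 'b) module"
  assumes module_M: "module K M"
begin

interpretation module K M by (fact module_M)

private abbreviation (input) F where "F n \<equiv> free_module K (words M n)"

interpretation F: module K "F n" for n by (rule R.module_free_module)

lemma free_words_closed: "f \<in> carrier (F n) \<Longrightarrow> f u \<in> carrier K"
  by (simp add: carrier_free_module)

lemma free_words_length: "f \<in> carrier (F n) \<Longrightarrow> f u \<noteq> \<zero>\<^bsub>K\<^esub> \<Longrightarrow> length u = n"
  by (auto simp: carrier_free_module words_def)

lemma word_convolution_apply:
  assumes "f \<in> carrier (F m)" "g \<in> carrier (F n)"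
  shows "word_convolution K f g w =
    (if m \<le> length w then f (take m w) \<otimes>\<^bsub>K\<^esub> g (drop m w) else \<zero>\<^bsub>K\<^esub>)"
  using assms by (intro R.word_convolution_homogeneous) (auto simp: free_words_closed free_words_length)

lemma word_convolution_closed:
  assumes f: "f \<in> carrier (F m)" and g: "g \<in> carrier (F n)"
  shows "word_convolution K f g \<in> carrier (F (m + n))"
proof -
  \<comment> \<open>The concatenations of a word in the support of \<open>f\<close> with one in the
    support of \<open>g\<close>: a finite set that bounds the support of the product.\<close>
  let ?P = "(\<lambda>(u, v). u @ v) ` ({u. f u \<noteq> \<zero>\<^bsub>K\<^esub>} \<times> {v. g v \<noteq> \<zero>\<^bsub>K\<^esub>})"
  note fg = free_words_closed[OF f] free_words_closed[OF g]
  have "w \<in> ?P" if "word_convolution K f g w \<noteq> \<zero>\<^bsub>K\<^esub>" for w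
  proof (rule image_eqI[where x = "(take m w, drop m w)"])
    show "(take m w, drop m w) \<in> {u. f u \<noteq> \<zero>\<^bsub>K\<^esub>} \<times> {v. g v \<noteq> \<zero>\<^bsub>K\<^esub>}"
      using that fg by (auto simp: word_convolution_apply[OF f g] split: if_splits)
  qed simp
  then have sub: "{w. word_convolution K f g w \<noteq> \<zero>\<^bsub>K\<^esub>} \<subseteq> ?P" by blast
  have "?P \<subseteq> words M (m + n)"
    using f g by (fastforce simp: carrier_free_module words_def)
  moreover have "finite ?P"
    using f g by (auto simp: carrier_free_module)
  moreover have "word_convolution K f g w \<in> carrier K" for w
    using fg by (simp add: word_convolution_apply[OF f g])
  ultimately show ?thesis
    using sub finite_subset[OF sub] unfolding carrier_free_module by blast
qed

lemma linear_map_word_convolution_left: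
  assumes g: "g \<in> carrier (F n)"
  shows "linear_map K (F m) (F (m + n)) (\<lambda>f. word_convolution K f g)"
  unfolding linear_map_def
proof (intro conjI ballI funcsetI)
  fix f f' assume f: "f \<in> carrier (F m)" "f' \<in> carrier (F m)"
  note fg = f[THEN free_words_closed] free_words_closed[OF g]
  show "word_convolution K (f \<oplus>\<^bsub>F m\<^esub> f') g = word_convolution K f g \<oplus>\<^bsub>F (m + n)\<^esub> word_convolution K f' g"
    unfolding word_convolution_apply[OF F.add.m_closed[OF f] g, abs_def]
    using f fg by (auto simp: fun_eq_iff word_convolution_apply[OF _ g] R.l_distr)
next
  fix a f assume a: "a \<in> carrier K" and f: "f \<in> carrier (F m)"
  note fg = free_words_closed[OF f] free_words_closed[OF g]
  have "word_convolution K (a \<odot>\<^bsub>F m\<^esub> f) g w = (a \<odot>\<^bsub>F (m + n)\<^esub> word_convolution K f g) w" for w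
    unfolding word_convolution_apply[OF F.smult_closed[OF a f] g]
    using a f fg by (auto simp: word_convolution_apply[OF _ g] R.m_assoc)
  then show "word_convolution K (a \<odot>\<^bsub>F m\<^esub> f) g = a \<odot>\<^bsub>F (m + n)\<^esub> word_convolution K f g" ..
qed (rule word_convolution_closed[OF _ g])

lemma linear_map_word_convolution_right:
  assumes f: "f \<in> carrier (F m)"
  shows "linear_map K (F n) (F (m + n)) (word_convolution K f)"
  unfolding linear_map_def
proof (intro conjI ballI funcsetI)
  fix g g' assume g: "g \<in> carrier (F n)" "g' \<in> carrier (F n)"
  note fg = g[THEN free_words_closed] free_words_closed[OF f]
  have "word_convolution K f (g \<oplus>\<^bsub>F n\<^esub> g') w = (word_convolution K f g \<oplus>\<^bsub>F (m + n)\<^esub> word_convolution K f g') w" for w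
    unfolding word_convolution_apply[OF f F.add.m_closed[OF g]]
    using g fg by (auto simp: word_convolution_apply[OF f] R.r_distr)
  then show "word_convolution K f (g \<oplus>\<^bsub>F n\<^esub> g') = word_convolution K f g \<oplus>\<^bsub>F (m + n)\<^esub> word_convolution K f g'" ..
next
  fix a g assume a: "a \<in> carrier K" and g: "g \<in> carrier (F n)"
  note fg = free_words_closed[OF f] free_words_closed[OF g]
  \<comment> \<open>Here the scalar has to pass a coefficient of \<open>f\<close>, so commutativity
    of \<open>K\<close> enters.\<close>
  have "word_convolution K f (a \<odot>\<^bsub>F n\<^esub> g) w = (a \<odot>\<^bsub>F (m + n)\<^esub> word_convolution K f g) w" for w
    unfolding word_convolution_apply[OF f F.smult_closed[OF a g]]
    using a g fg by (auto simp: word_convolution_apply[OF f] R.m_lcomm)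
  then show "word_convolution K f (a \<odot>\<^bsub>F n\<^esub> g) = a \<odot>\<^bsub>F (m + n)\<^esub> word_convolution K f g" ..
qed (rule word_convolution_closed[OF f])

section \<open>The multilinearity relations and the two-sided ideal that they generate\<close>

lemma tensor_relationE:
  assumes "r \<in> tensor_relations K M n"
  obtains (add) u x y v where
      "r = free_gen K (u @ [x \<oplus>\<^bsub>M\<^esub> y] @ v) \<ominus>\<^bsub>F n\<^esub>
         (free_gen K (u @ [x] @ v) \<oplus>\<^bsub>F n\<^esub> free_gen K (u @ [y] @ v))"
      "u @ [x] @ v \<in> words M n" "u @ [y] @ v \<in> words M n" "u @ [x \<oplus>\<^bsub>M\<^esub> y] @ v \<in> words M n"
      "y \<in> carrier M"
  | (smult) u a x v where
      "r = free_gen K (u @ [a \<odot>\<^bsub>M\<^esub> x] @ v) \<ominus>\<^bsub>F n\<^esub> (a \<odot>\<^bsub>F n\<^esub> free_gen K (u @ [x] @ v))"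
      "u @ [x] @ v \<in> words M n" "u @ [a \<odot>\<^bsub>M\<^esub> x] @ v \<in> words M n" "a \<in> carrier K"
proof -
  \<comment> \<open>A relation records this for the word with letter \<open>x\<close> only; for the
    other words it follows from closure of \<open>M\<close> under its operations.\<close>
  have 1: "u @ [y] @ v \<in> words M n" "u @ [x \<oplus>\<^bsub>M\<^esub> y] @ v \<in> words M n"
    if "u @ [x] @ v \<in> words M n" "y \<in> carrier M" for u x y v
    using that by (auto simp: words_def)
  have 2: "u @ [a \<odot>\<^bsub>M\<^esub> x] @ v \<in> words M n"
    if "u @ [x] @ v \<in> words M n" "a \<in> carrier K" for u x a v
    using that by (auto simp: words_def)
  from assms show thesis
    unfolding tensor_relations_def Let_def
  proof (elim UnE CollectE exE conjE)
    fix u x y v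
    assume *: "r = free_gen K (u @ [x \<oplus>\<^bsub>M\<^esub> y] @ v) \<ominus>\<^bsub>F n\<^esub>
         (free_gen K (u @ [x] @ v) \<oplus>\<^bsub>F n\<^esub> free_gen K (u @ [y] @ v))"
      "u @ [x] @ v \<in> words M n" "y \<in> carrier M"
    show thesis by (rule add[OF *(1,2) 1[OF *(2,3)] *(3)])
  next
    fix u a x v
    assume *: "r = free_gen K (u @ [a \<odot>\<^bsub>M\<^esub> x] @ v) \<ominus>\<^bsub>F n\<^esub> (a \<odot>\<^bsub>F n\<^esub> free_gen K (u @ [x] @ v))"
      "u @ [x] @ v \<in> words M n" "a \<in> carrier K"
    show thesis by (rule smult[OF *(1,2) 2[OF *(2,3)] *(3)])
  qed
qed

lemma tensor_relations_subset: "tensor_relations K M n \<subseteq> carrier (F n)"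
proof
  fix r assume "r \<in> tensor_relations K M n"
  then show "r \<in> carrier (F n)"
  proof (cases rule: tensor_relationE)
    case (add u x y v)
    note g = add(2-4)[THEN R.free_gen_closed]
    show ?thesis
      unfolding add(1) by (intro F.minus_closed F.add.m_closed g)
  next
    case (smult u a x v)
    note g = smult(2,3)[THEN R.free_gen_closed]
    show ?thesis
      unfolding smult(1) by (intro F.minus_closed F.smult_closed smult(4) g)
  qed
qed

lemma submodule_tensor_kernel: "submodule (tensor_kernel K M n) K (F n)"
  unfolding tensor_kernel_def
  by (intro submodule_module_span F.module_axioms tensor_relations_subset)

lemma tensor_kernel_subset: "k \<in> tensor_kernel K M n \<Longrightarrow> k \<in> carrier (F n)"
  using F.submoduleE(1)[OF submodule_tensor_kernel] by blast

lemma words_append: "u \<in> words M m \<Longrightarrow> v \<in> words M n \<Longrightarrow> u @ v \<in> words M (m + n)"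
  by (auto simp: words_def)

text \<open>Relations allow any context around the changed letter, so \<open>w\<close> is absorbed
  into the right context as \<open>v @ w\<close> or into the left one as \<open>w @ u\<close>. The
  product is itself a relation, not merely a combination of relations.\<close>

lemma tensor_relations_append:
  assumes r: "r \<in> tensor_relations K M n" and w: "w \<in> words M m"
  shows "word_convolution K r (free_gen K w) \<in> tensor_relations K M (n + m)"
    and "word_convolution K (free_gen K w) r \<in> tensor_relations K M (m + n)"
proof -
  note gen = R.free_gen_closed[of _ "words M n"]
  note gw = R.free_gen_closed[OF w]
  note left = linear_map_word_convolution_left[OF gw, of n]
  note right = linear_map_word_convolution_right[OF gw, of n]
  note lin = linear_mapD(2,3)[OF left] F.linear_map_minus[OF left F.module_axioms]
    linear_mapD(2,3)[OF right] F.linear_map_minus[OF right F.module_axioms]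
  from r have "word_convolution K r (free_gen K w) \<in> tensor_relations K M (n + m) \<and>
    word_convolution K (free_gen K w) r \<in> tensor_relations K M (m + n)"
  proof (cases rule: tensor_relationE)
    case (add u x y v)
    note g = add(2-4)[THEN gen]
    have "word_convolution K r (free_gen K w) =
        free_gen K (u @ [x \<oplus>\<^bsub>M\<^esub> y] @ (v @ w)) \<ominus>\<^bsub>F (n + m)\<^esub>
         (free_gen K (u @ [x] @ (v @ w)) \<oplus>\<^bsub>F (n + m)\<^esub> free_gen K (u @ [y] @ (v @ w)))"
      unfolding add(1) by (simp only: lin g F.add.m_closed R.word_convolution_free_gen append_assoc)
    moreover have "u @ [x] @ (v @ w) \<in> words M (n + m)"
      using words_append[OF add(2) w] by simp
    moreover have "word_convolution K (free_gen K w) r =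
        free_gen K ((w @ u) @ [x \<oplus>\<^bsub>M\<^esub> y] @ v) \<ominus>\<^bsub>F (m + n)\<^esub>
         (free_gen K ((w @ u) @ [x] @ v) \<oplus>\<^bsub>F (m + n)\<^esub> free_gen K ((w @ u) @ [y] @ v))"
      unfolding add(1) by (simp only: lin g F.add.m_closed R.word_convolution_free_gen append_assoc)
    moreover have "(w @ u) @ [x] @ v \<in> words M (m + n)"
      using words_append[OF w add(2)] by simp
    ultimately show ?thesis
      unfolding tensor_relations_def Let_def using add(5) by blast
  next
    case (smult u a x v)
    note g = smult(2,3)[THEN gen]
    have "word_convolution K r (free_gen K w) =
        free_gen K (u @ [a \<odot>\<^bsub>M\<^esub> x] @ (v @ w)) \<ominus>\<^bsub>F (n + m)\<^esub>
         (a \<odot>\<^bsub>F (n + m)\<^esub> free_gen K (u @ [x] @ (v @ w)))"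
      unfolding smult(1)
      by (simp only: lin g smult(4) F.smult_closed R.word_convolution_free_gen append_assoc)
    moreover have "u @ [x] @ (v @ w) \<in> words M (n + m)"
      using words_append[OF smult(2) w] by simp
    moreover have "word_convolution K (free_gen K w) r =
        free_gen K ((w @ u) @ [a \<odot>\<^bsub>M\<^esub> x] @ v) \<ominus>\<^bsub>F (m + n)\<^esub>
         (a \<odot>\<^bsub>F (m + n)\<^esub> free_gen K ((w @ u) @ [x] @ v))"
      unfolding smult(1)
      by (simp only: lin g smult(4) F.smult_closed R.word_convolution_free_gen append_assoc)
    moreover have "(w @ u) @ [x] @ v \<in> words M (m + n)"
      using words_append[OF w smult(2)] by simp
    ultimately show ?thesis
      unfolding tensor_relations_def Let_def using smult(4) by blast
  qed
  then show "word_convolution K r (free_gen K w) \<in> tensor_relations K M (n + m)"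
    and "word_convolution K (free_gen K w) r \<in> tensor_relations K M (m + n)" by auto
qed

lemma tensor_relations_kernel: "tensor_relations K M n \<subseteq> tensor_kernel K M n"
  unfolding tensor_kernel_def by (rule module_span_superset)

text \<open>Linearity is used in one factor at a time: with a word on the right, the left factor
  runs from the relations to their span; then, with \<open>k\<close> fixed, the right factor runs
  from words to all of the free module.\<close>

lemma tensor_kernel_convolution_left:
  assumes k: "k \<in> tensor_kernel K M m" and g: "g \<in> carrier (F n)"
  shows "word_convolution K k g \<in> tensor_kernel K M (m + n)"
proof -
  have gen: "word_convolution K k (free_gen K w) \<in> tensor_kernel K M (m + n)"
    if w: "w \<in> words M n" for w
  proof -
    let ?N = "{f \<in> carrier (F m). word_convolution K f (free_gen K w) \<in> tensor_kernel K M (m + n)}"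
    have "submodule ?N K (F m)"
      using w by (intro F.submodule_vimage[where N = "F (m + n)"] linear_map_word_convolution_left F.module_axioms
        submodule_tensor_kernel R.free_gen_closed)
    moreover have "tensor_relations K M m \<subseteq> ?N"
      using tensor_relations_subset tensor_relations_append(1)[OF _ w] tensor_relations_kernel by blast
    ultimately have "tensor_kernel K M m \<subseteq> ?N"
      unfolding tensor_kernel_def[of K M m] by (rule module_span_least)
    then show ?thesis using k by blast
  qed
  \<comment> \<open>Now \<open>k\<close> is fixed and the right factor varies; words belong to this
    set by \<open>gen\<close>.\<close>
  let ?N = "{g \<in> carrier (F n). word_convolution K k g \<in> tensor_kernel K M (m + n)}"
  have "submodule ?N K (F n)"
    using tensor_kernel_subset[OF k] by (intro F.submodule_vimage[where N = "F (m + n)"] linear_map_word_convolution_right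
      F.module_axioms submodule_tensor_kernel)
  then have "carrier (F n) \<subseteq> ?N"
    by (rule R.free_module_subset) (simp add: gen R.free_gen_closed)
  then show ?thesis using g by blast
qed

text \<open>The mirror image; together the two facts say that the kernels form a graded two-sided
  ideal.\<close>

lemma tensor_kernel_convolution_right:
  assumes f: "f \<in> carrier (F m)" and k: "k \<in> tensor_kernel K M n"
  shows "word_convolution K f k \<in> tensor_kernel K M (m + n)"
proof -
  have gen: "word_convolution K (free_gen K w) k \<in> tensor_kernel K M (m + n)"
    if w: "w \<in> words M m" for w
  proof -
    let ?N = "{g \<in> carrier (F n). word_convolution K (free_gen K w) g \<in> tensor_kernel K M (m + n)}"
    have "submodule ?N K (F n)"
      using w by (intro F.submodule_vimage[where N = "F (m + n)"] linear_map_word_convolution_right F.module_axioms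
        submodule_tensor_kernel R.free_gen_closed)
    moreover have "tensor_relations K M n \<subseteq> ?N"
      using tensor_relations_subset tensor_relations_append(2)[OF _ w] tensor_relations_kernel by blast
    ultimately have "tensor_kernel K M n \<subseteq> ?N"
      unfolding tensor_kernel_def[of K M n] by (rule module_span_least)
    then show ?thesis using k by blast
  qed
  let ?N = "{f \<in> carrier (F m). word_convolution K f k \<in> tensor_kernel K M (m + n)}"
  have "submodule ?N K (F m)"
    using tensor_kernel_subset[OF k] by (intro F.submodule_vimage[where N = "F (m + n)"] linear_map_word_convolution_left
      F.module_axioms submodule_tensor_kernel)
  then have "carrier (F m) \<subseteq> ?N"
    by (rule R.free_module_subset) (simp add: gen R.free_gen_closed)
  then show ?thesis using f by blast
qed

section \<open>Products of tensor classes computed on representatives\<close>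

lemma tensor_mult_rcoset:
  assumes f: "f \<in> carrier (F m)" and g: "g \<in> carrier (F n)"
  shows "tensor_mult K M m n
      (tensor_kernel K M m +>\<^bsub>F m\<^esub> f) (tensor_kernel K M n +>\<^bsub>F n\<^esub> g) =
    tensor_kernel K M (m + n) +>\<^bsub>F (m + n)\<^esub> word_convolution K f g"
proof -
  let ?k = "tensor_kernel K M" and ?c = "word_convolution K"
  let ?C = "?k m +>\<^bsub>F m\<^esub> f" and ?D = "?k n +>\<^bsub>F n\<^esub> g" and ?E = "?k (m + n) +>\<^bsub>F (m + n)\<^esub> ?c f g"
  have eq: "?k (m + n) +>\<^bsub>F (m + n)\<^esub> ?c f' g' = ?E" if f': "f' \<in> ?C" and g': "g' \<in> ?D" for f' g'
  proof -
    from f' obtain k where k: "k \<in> ?k m" "f' = k \<oplus>\<^bsub>F m\<^esub> f" unfolding a_r_coset_def' by blast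
    from g' obtain l where l: "l \<in> ?k n" "g' = l \<oplus>\<^bsub>F n\<^esub> g" unfolding a_r_coset_def' by blast
    note kl = tensor_kernel_subset[OF k(1)] tensor_kernel_subset[OF l(1)]
    have g'c: "g' \<in> carrier (F n)" unfolding l(2) using kl g by (intro F.add.m_closed)
    have ker: "?c k g' \<in> ?k (m + n)" "?c f l \<in> ?k (m + n)"
      by (intro tensor_kernel_convolution_left[OF k(1) g'c] tensor_kernel_convolution_right[OF f l(1)])+
    \<comment> \<open>The left factor is expanded first while \<open>g'\<close> stays whole. This
      leaves just two error terms, \<open>k\<close> times \<open>g'\<close> and \<open>f\<close>
      times \<open>l\<close>, one for each side of the ideal property.\<close>
    have "?c f' g' = ?c k g' \<oplus>\<^bsub>F (m + n)\<^esub> ?c f g'"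
      unfolding k(2) by (rule linear_mapD(2)[OF linear_map_word_convolution_left[OF g'c] kl(1) f])
    also have "?c f g' = ?c f l \<oplus>\<^bsub>F (m + n)\<^esub> ?c f g"
      unfolding l(2) by (rule linear_mapD(2)[OF linear_map_word_convolution_right[OF f] kl(2) g])
    also have "?c k g' \<oplus>\<^bsub>F (m + n)\<^esub> (?c f l \<oplus>\<^bsub>F (m + n)\<^esub> ?c f g) =
        (?c k g' \<oplus>\<^bsub>F (m + n)\<^esub> ?c f l) \<oplus>\<^bsub>F (m + n)\<^esub> ?c f g"
      by (intro F.a_assoc[symmetric] tensor_kernel_subset ker word_convolution_closed f g)
    finally have "?c f' g' \<in> ?E"
      using F.submoduleE(5)[OF submodule_tensor_kernel ker] unfolding a_r_coset_def' by blast
    then show ?thesis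
      by (rule rcoset_eqI[OF F.module_axioms submodule_tensor_kernel])
        (rule word_convolution_closed[OF f g])
  qed
  interpret m: abelian_subgroup "?k m" "F m"
    by (rule F.abelian_subgroup_submodule[OF submodule_tensor_kernel])
  interpret n: abelian_subgroup "?k n" "F n"
    by (rule F.abelian_subgroup_submodule[OF submodule_tensor_kernel])
  have "tensor_mult K M m n ?C ?D = (\<Union>f'\<in>?C. \<Union>g'\<in>?D. ?E)"
    unfolding tensor_mult_def by (intro SUP_cong refl eq)
  \<comment> \<open>Non-emptiness lets the constant double union collapse.\<close>
  moreover have "?C \<noteq> {}" "?D \<noteq> {}"
    using m.a_rcos_self[OF f] n.a_rcos_self[OF g] by blast+
  ultimately show ?thesis by simp
qed

lemma carrier_tensor_powerE:
  assumes "C \<in> carrier (tensor_power K M n)"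
  obtains f where "f \<in> carrier (F n)" "C = tensor_kernel K M n +>\<^bsub>F n\<^esub> f"
  using assms unfolding tensor_power_def by (auto simp: A_RCOSETS_def')

lemma module_tensor_power: "module K (tensor_power K M n)"
  unfolding tensor_power_def
  by (rule module_quotient_module[OF F.module_axioms submodule_tensor_kernel])

lemma tensor_mult_closed:
  assumes "C \<in> carrier (tensor_power K M m)" "D \<in> carrier (tensor_power K M n)"
  shows "tensor_mult K M m n C D \<in> carrier (tensor_power K M (m + n))"
proof -
  obtain f where f: "f \<in> carrier (F m)" "C = tensor_kernel K M m +>\<^bsub>F m\<^esub> f"
    using assms(1) by (rule carrier_tensor_powerE)
  obtain g where g: "g \<in> carrier (F n)" "D = tensor_kernel K M n +>\<^bsub>F n\<^esub> g"
    using assms(2) by (rule carrier_tensor_powerE)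
  show ?thesis
    unfolding f(2) g(2) tensor_mult_rcoset[OF f(1) g(1)] tensor_power_def
    by (intro linear_mapD(1)[OF linear_map_rcoset[where K = K]] F.module_axioms submodule_tensor_kernel
      word_convolution_closed f(1) g(1))
qed

lemma Nil_words: "free_gen K [] \<in> carrier (F 0)"
  by (rule R.free_gen_closed) (simp add: words_def)

lemma tensor_mult_Nil_left:
  assumes "D \<in> carrier (tensor_power K M n)"
  shows "tensor_mult K M 0 n (pure_tensor K M []) D = D"
proof -
  from assms obtain g where g: "g \<in> carrier (F n)" "D = tensor_kernel K M n +>\<^bsub>F n\<^esub> g"
    by (rule carrier_tensor_powerE)
  show ?thesis
    using tensor_mult_rcoset[OF Nil_words g(1)] free_words_closed[OF g(1)]
    by (simp add: pure_tensor_def g(2) R.word_convolution_Nil_left)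
qed

lemma tensor_mult_Nil_right:
  assumes "C \<in> carrier (tensor_power K M n)"
  shows "tensor_mult K M n 0 C (pure_tensor K M []) = C"
proof -
  from assms obtain f where f: "f \<in> carrier (F n)" "C = tensor_kernel K M n +>\<^bsub>F n\<^esub> f"
    by (rule carrier_tensor_powerE)
  have "word_convolution K f (free_gen K []) = f"
    using free_words_closed[OF f(1)] free_words_length[OF f(1)]
    by (rule R.word_convolution_Nil_right)
  then show ?thesis
    using tensor_mult_rcoset[OF f(1) Nil_words] by (simp add: pure_tensor_def f(2))
qed

text \<open>The coset of \<open>free_gen K w\<close> contains \<open>free_gen K w\<close>, and a
  coset of an element of the free module stays inside it. The conclusion speaks of the generator and
  not of the word, since over the zero ring every generator vanishes, whatever its word.\<close>

lemma pure_tensor_closedD: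
  assumes "pure_tensor K M w \<in> carrier (tensor_power K M (length w))"
  shows "free_gen K w \<in> carrier (F (length w))"
proof -
  let ?n = "length w"
  obtain f where f: "f \<in> carrier (F ?n)" "pure_tensor K M w = tensor_kernel K M ?n +>\<^bsub>F ?n\<^esub> f"
    using assms by (rule carrier_tensor_powerE)
  \<comment> \<open>Checked coefficientwise: the neutral law of the module would require the
    membership that is being proved.\<close>
  have "\<zero>\<^bsub>F ?n\<^esub> \<oplus>\<^bsub>F ?n\<^esub> free_gen K w = free_gen K w"
    by (simp add: fun_eq_iff)
  then have "free_gen K w \<in> tensor_kernel K M ?n +>\<^bsub>F ?n\<^esub> free_gen K w"
    unfolding a_r_coset_def'
    by (intro UN_I[OF F.submodule_zero[OF submodule_tensor_kernel]]) (simp only: singleton_iff)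
  then have "free_gen K w \<in> tensor_kernel K M ?n +>\<^bsub>F ?n\<^esub> f"
    using f(2) by (simp add: pure_tensor_def)
  then obtain k where k: "k \<in> tensor_kernel K M ?n" "free_gen K w = k \<oplus>\<^bsub>F ?n\<^esub> f"
    unfolding a_r_coset_def' by blast
  then show ?thesis
    using F.add.m_closed[OF tensor_kernel_subset[OF k(1)] f(1)] by simp
qed

text \<open>Only the tensors are assumed to lie in the tensor powers, not the letters in \<open>M\<close>:
  this covers the classes of loops without showing that loops are cycles.\<close>

lemma tensor_mult_pure_tensor:
  assumes "pure_tensor K M u \<in> carrier (tensor_power K M (length u))"
    and "pure_tensor K M v \<in> carrier (tensor_power K M (length v))"
  shows "tensor_mult K M (length u) (length v) (pure_tensor K M u) (pure_tensor K M v) =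
    pure_tensor K M (u @ v)"
  using tensor_mult_rcoset[OF assms[THEN pure_tensor_closedD]]
  by (simp add: pure_tensor_def R.word_convolution_free_gen)

section \<open>The degree two component of a product\<close>

lemma completed_tensor_algebra_mult_2:
  fixes s t :: "nat \<Rightarrow> ('b list \<Rightarrow> 'k) set"
  defines "T \<equiv> completed_tensor_algebra K M"
  assumes s: "s \<in> carrier T" and t: "t \<in> carrier T"
    and s0: "s 0 = pure_tensor K M []" and t0: "t 0 = pure_tensor K M []"
    and s1: "s 1 = pure_tensor K M [x]" and t1: "t 1 = pure_tensor K M [y]"
  shows "(s \<otimes>\<^bsub>T\<^esub> t) 2 =
      s 2 \<oplus>\<^bsub>tensor_power K M 2\<^esub> (pure_tensor K M [x, y] \<oplus>\<^bsub>tensor_power K M 2\<^esub> t 2)"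
    and "pure_tensor K M [x, y] \<in> carrier (tensor_power K M 2)"
proof -
  let ?P = "tensor_power K M"
  interpret P: module K "?P 2" by (rule module_tensor_power)
  have s': "s n \<in> carrier (?P n)" and t': "t n \<in> carrier (?P n)" for n
    using s t by (auto simp: T_def completed_tensor_algebra_def)
  let ?h = "\<lambda>i. tensor_mult K M i (2 - i) (s i) (t (2 - i))"
  have h: "?h i \<in> carrier (?P 2)" if "i \<le> 2" for i
    using tensor_mult_closed[OF s'[of i] t'[of "2 - i"]] that by simp
  have h0: "?h 0 = t 2" using tensor_mult_Nil_left[OF t'] by (simp add: s0)
  have h2: "?h 2 = s 2" using tensor_mult_Nil_right[OF s'] by (simp add: t0)
  \<comment> \<open>The simplifier writes the index 1 as \<open>Suc 0\<close>, so the hypotheses on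
    \<open>s 1\<close> and \<open>t 1\<close> are brought into the same form.\<close>
  have h1: "?h 1 = pure_tensor K M [x, y]"
    using tensor_mult_pure_tensor[of "[x]" "[y]"] s'[of 1] t'[of 1] by (simp add: s1[simplified] t1[simplified])
  \<comment> \<open>The mixed tensor lies in the tensor square because it is a product of two
    components of degree one.\<close>
  show "pure_tensor K M [x, y] \<in> carrier (?P 2)" using h[of 1] h1 by simp
  have "(s \<otimes>\<^bsub>T\<^esub> t) 2 = finsum (?P 2) ?h {..2}"
    by (simp add: T_def completed_tensor_algebra_def)
  \<comment> \<open>Listing the indices downwards makes \<open>finsum_insert\<close> produce the
    summands in the order of the claim, nested to the right.\<close>
  also have "{..2::nat} = {2, 1, 0}" by auto
  also have "finsum (?P 2) ?h {2, 1, 0} = ?h 2 \<oplus>\<^bsub>?P 2\<^esub> (?h 1 \<oplus>\<^bsub>?P 2\<^esub> ?h 0)"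
    using h[of 0] h[of 1] h[of 2] by (simp del: One_nat_def add: P.finsum_insert P.finsum_empty)
  finally show "(s \<otimes>\<^bsub>T\<^esub> t) 2 = s 2 \<oplus>\<^bsub>?P 2\<^esub> (pure_tensor K M [x, y] \<oplus>\<^bsub>?P 2\<^esub> t 2)"
    unfolding h0 h1 h2 .
qed

end

section \<open>The quadratic relation for the second term of an expansion\<close>

theorem lemma5p1:
  fixes K :: "('k, 'r) ring_scheme"
    and \<Sigma> :: "'a topology"
    and A :: "'a chart set"
    and b :: 'a
    and \<theta> :: "(real \<Rightarrow> 'a) set \<Rightarrow> nat \<Rightarrow> (('a sing_simplex \<Rightarrow> 'k) set list \<Rightarrow> 'k) set"
    and flat :: "(('a sing_simplex \<Rightarrow> 'k) set list \<Rightarrow> 'k) set \<Rightarrow> 'k"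
  assumes "cring K"
    and "oriented_smooth_surface \<Sigma> A"
    and "compact_space \<Sigma>"
    and "connected_space \<Sigma>"
    and "surface_boundary A \<noteq> {}"
    and "b \<in> surface_boundary A"
    and "is_intersection_form K \<Sigma> A flat"
    and "is_expansion K \<Sigma> b \<theta>"
  shows "(\<lambda>\<gamma>. flat (\<theta> \<gamma> 2)) \<in> quadratic_forms K \<Sigma> b flat"
proof -
  interpret K: cring K by fact
  let ?H = "homology K \<Sigma> 1" and ?G = "fundamental_group \<Sigma> b"
  let ?T = "completed_tensor_algebra K ?H" and ?P = "tensor_power K ?H 2"
  have H: "module K ?H" by (rule K.module_homology) simp
  interpret P: module K ?P by (rule module_tensor_power[OF H])
  have flat: "flat \<in> carrier ?P \<rightarrow> carrier K"
    "\<And>x y. \<lbrakk>x \<in> carrier ?P; y \<in> carrier ?P\<rbrakk> \<Longrightarrow> flat (x \<oplus>\<^bsub>?P\<^esub> y) = flat x \<oplus>\<^bsub>K\<^esub> flat y"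
    using assms(7) unfolding is_intersection_form_def linear_form_def by blast+
  have hom: "\<theta> \<in> hom ?G (units_of ?T)"
    and low: "\<And>\<gamma>. \<gamma> \<in> carrier ?G \<Longrightarrow> \<theta> \<gamma> 0 = pure_tensor K ?H [] \<and>
      \<theta> \<gamma> 1 = pure_tensor K ?H [homology_class K \<Sigma> \<gamma>]"
    using assms(8) unfolding is_expansion_def by blast+
  \<comment> \<open>A unit of the completed algebra is in particular an element of it, which places
    each component in its tensor power.\<close>
  have closed: "\<theta> \<gamma> \<in> carrier ?T" if "\<gamma> \<in> carrier ?G" for \<gamma>
    using hom_in_carrier[OF hom that] by (simp add: units_of_def Units_def)
  then have closed2: "\<theta> \<gamma> 2 \<in> carrier ?P" if "\<gamma> \<in> carrier ?G" for \<gamma>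
    using that by (simp add: completed_tensor_algebra_def)
  show ?thesis
    unfolding quadratic_forms_def
  proof (intro CollectI conjI funcsetI ballI)
    fix \<gamma> assume "\<gamma> \<in> carrier ?G"
    then show "flat (\<theta> \<gamma> 2) \<in> carrier K" using closed2 flat(1) by blast
  next
    fix \<gamma>\<^sub>1 \<gamma>\<^sub>2 assume \<gamma>: "\<gamma>\<^sub>1 \<in> carrier ?G" "\<gamma>\<^sub>2 \<in> carrier ?G"
    let ?xy = "pure_tensor K ?H [homology_class K \<Sigma> \<gamma>\<^sub>1, homology_class K \<Sigma> \<gamma>\<^sub>2]"
    note mult = completed_tensor_algebra_mult_2[OF H \<gamma>[THEN closed]
      \<gamma>[THEN low, THEN conjunct1] \<gamma>[THEN low, THEN conjunct2]]
    \<comment> \<open>The group of units inherits its multiplication from the algebra.\<close>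
    have "\<theta> (\<gamma>\<^sub>1 \<otimes>\<^bsub>?G\<^esub> \<gamma>\<^sub>2) = \<theta> \<gamma>\<^sub>1 \<otimes>\<^bsub>?T\<^esub> \<theta> \<gamma>\<^sub>2"
      using hom_mult[OF hom \<gamma>] by (simp add: units_of_def)
    then have "\<theta> (\<gamma>\<^sub>1 \<otimes>\<^bsub>?G\<^esub> \<gamma>\<^sub>2) 2 = \<theta> \<gamma>\<^sub>1 2 \<oplus>\<^bsub>?P\<^esub> (?xy \<oplus>\<^bsub>?P\<^esub> \<theta> \<gamma>\<^sub>2 2)"
      using mult(1) by simp
    then have "flat (\<theta> (\<gamma>\<^sub>1 \<otimes>\<^bsub>?G\<^esub> \<gamma>\<^sub>2) 2) =
        flat (\<theta> \<gamma>\<^sub>1 2) \<oplus>\<^bsub>K\<^esub> (flat ?xy \<oplus>\<^bsub>K\<^esub> flat (\<theta> \<gamma>\<^sub>2 2))"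
      using \<gamma>[THEN closed2] mult(2) by (simp only: flat(2) P.add.m_closed)
    moreover have "flat ?xy \<in> carrier K" "flat (\<theta> \<gamma>\<^sub>1 2) \<in> carrier K" "flat (\<theta> \<gamma>\<^sub>2 2) \<in> carrier K"
      using \<gamma>[THEN closed2] mult(2) flat(1) by blast+
    \<comment> \<open>The product formula has the mixed term in the middle, the quadratic relation
      has it last; commutativity of addition in \<open>K\<close> reconciles them.\<close>
    ultimately show "flat (\<theta> (\<gamma>\<^sub>1 \<otimes>\<^bsub>?G\<^esub> \<gamma>\<^sub>2) 2) = flat (\<theta> \<gamma>\<^sub>1 2) \<oplus>\<^bsub>K\<^esub> flat (\<theta> \<gamma>\<^sub>2 2) \<oplus>\<^bsub>K\<^esub>
        intersection_number K \<Sigma> flat (homology_class K \<Sigma> \<gamma>\<^sub>1) (homology_class K \<Sigma> \<gamma>\<^sub>2)"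
      by (simp add: intersection_number_def K.a_ac)
  qed
qed

end
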